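(* Let $T$ be distributed according to the uniform spanning tree measure $\mathbb P$ of the (wired) finite graph $\mathcal G=(\Lambda,E)$ described in the context. Let $F,G\subseteq E$ with $F\cap G=\emptyset$. Then $$\mathbb P\big(F\subseteq T,\ G\cap T=\emptyset\big)=\Big\langle \prod_{f\in F}\zeta(f)\prod_{g\in G}\big(1-\zeta(g)\big)\Big\rangle=\det\big(M^{(|F|)}\big),$$ where, enumerating $F\cup G$ so that the edges with indices $1,\dots,|F|$ are those of $F$ and the edges with indices $|F|+1,\dots,|F|+|G|$ are those of $G$, and writing $M(i,j)$ for the transfer-current matrix entry between the $i$-th and the $j$-th edge, $M^{(|F|)}$ is the $(|F|+|G|)\times(|F|+|G|)$ matrix $$M^{(|F|)}(i,j)=\begin{cases} M(i,j) & \text{if } i\le |F|,\\ -M(i,j) & \text{if } |F|+1\le i\le |F|+|G|,\ i\ne j,\\ 1-M(i,j) & \text{if } |F|+1\le i\le |F|+|G|,\ i=j.\end{cases}$$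
   Context: **Graph.** Let $\mathbf L$ be a connected, locally finite simple graph (for example a lattice), and let $\Lambda$ be a finite nonempty proper subset of its vertex set. $E$ denotes the set of edges of $\mathbf L$ having at least one endpoint in $\Lambda$; each edge $e\in E$ is given a fixed orientation $e=(e^-,e^+)$ (tail, tip). The wired graph is the finite connected multigraph with edge set $E$ obtained by identifying all vertices outside $\Lambda$ to a single vertex. (An arbitrary finite connected graph is covered by taking $\Lambda$ to be all its vertices but one.) The uniform spanning tree (UST) measure $\mathbb P$ is the uniform probability measure on spanning trees of the wired graph; a spanning tree $T$ is viewed as a subset of $E$. **Laplacian, Green's function, transfer-current matrix.** $\Delta_\Lambda$ is the $\Lambda\times\Lambda$ matrix with $\Delta_\Lambda(u,u)=-|\{w\in\mathbf L: w\sim u\}|$, $\Delta_\Lambda(u,v)=1$ if $u\sim v$, and $0$ otherwise. The Green's function with Dirichlet boundary conditions is $G_\Lambda=(-\Delta_\Lambda)^{-1}$, extended by $G_\Lambda(u,v)=0$ if $u\notin\Lambda$ or $v\notin\Lambda$. For $f,g\in E$, $$M(f,g)=G_\Lambda(f^+,g^+)-G_\Lambda(f^+,g^-)-G_\Lambda(f^-,g^+)+G_\Lambda(f^-,g^-).$$ **Fermions.** $\Omega^{2\Lambda}$ is the real Grassmann algebra with generators $\psi_v,\bar\psi_v$ ($v\in\Lambda$), all of which anticommute with each other (in particular they square to $0$). For a generator $\xi$, $\partial_\xi$ is the left derivative: the linear map with $\partial_\xi(\xi P)=P$ and $\partial_\xi P=0$ for every $P$ not involving $\xi$. The normalized fermionic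 Gaussian free field state is the linear map $$\langle P\rangle=\frac{1}{\det(-\Delta_\Lambda)}\Big(\prod_{v\in\Lambda}\partial_{\bar\psi_v}\partial_{\psi_v}\Big)\exp\Big(\sum_{u,v\in\Lambda}\psi_u(-\Delta_\Lambda)(u,v)\bar\psi_v\Big)P,\qquad P\in\Omega^{2\Lambda}.$$ Put $\psi_v=\bar\psi_v=0$ for $v\notin\Lambda$. For $e\in E$, $$\zeta(e)=(\psi_{e^+}-\psi_{e^-})(\bar\psi_{e^+}-\bar\psi_{e^-}).$$ The elements $\zeta(e)$ commute with each other, satisfy $\zeta(e)^2=0$, and do not depend on the orientation of $e$. *)

theory Defs
  imports "HOL-Probability.Probability" "Jordan_Normal_Form.Determinant"
begin

section \<open>Grassmann algebras\<close>

text \<open>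
  The real Grassmann algebra on the generators \<open>'g\<close> is realised on the basis of monomials
  \<open>g\<^sub>1 * \<dots> * g\<^sub>k\<close> with \<open>g\<^sub>1 < \<dots> < g\<^sub>k\<close>, each identified with the finite set
  \<open>{g\<^sub>1, \<dots>, g\<^sub>k}\<close>, for an arbitrarily chosen well-order of the generators. Choosing another order
  changes only the signs of the basis monomials, i.e. gives an isomorphic algebra.
\<close>

definition gen_less :: "'g \<Rightarrow> 'g \<Rightarrow> bool" where
  "gen_less a b \<longleftrightarrow> (a, b) \<in> (SOME r. well_order_on UNIV r) \<and> a \<noteq> b"

lemma gen_less_linear: "a \<noteq> b \<Longrightarrow> gen_less a b \<longleftrightarrow> \<not> gen_less b a"
proof -
  have "well_order_on UNIV (SOME r :: ('a \<times> 'a) set. well_order_on UNIV r)"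
    by (rule someI_ex) (rule well_order_on)
  then show "a \<noteq> b \<Longrightarrow> gen_less a b \<longleftrightarrow> \<not> gen_less b a"
    unfolding gen_less_def well_order_on_def linear_order_on_def partial_order_on_def
      total_on_def antisym_def by blast
qed

text \<open>The sign needed to sort the concatenation of the monomials \<open>A\<close> and \<open>B\<close>.\<close>

definition shuffle_sign :: "'g set \<Rightarrow> 'g set \<Rightarrow> real" where
  "shuffle_sign A B = (-1) ^ card {(a, b). a \<in> A \<and> b \<in> B \<and> gen_less b a}"

lemma finite_inversions: "finite A \<Longrightarrow> finite B \<Longrightarrow> finite {(a, b). a \<in> A \<and> b \<in> B \<and> gen_less b a}"
  by (rule finite_subset[of _ "A \<times> B"]) auto

lemma shuffle_sign_empty [simp]: "shuffle_sign {} B = 1" "shuffle_sign A {} = 1"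
  by (simp_all add: shuffle_sign_def)

lemma shuffle_sign_sq [simp]: "shuffle_sign A B * shuffle_sign A B = 1"
  by (simp add: shuffle_sign_def flip: power_mult_distrib)

lemma shuffle_sign_Un_left:
  assumes "finite A" "finite B" "finite C" "A \<inter> B = {}"
  shows "shuffle_sign (A \<union> B) C = shuffle_sign A C * shuffle_sign B C"
proof -
  have "{(a, b). a \<in> A \<union> B \<and> b \<in> C \<and> gen_less b a}
      = {(a, b). a \<in> A \<and> b \<in> C \<and> gen_less b a} \<union> {(a, b). a \<in> B \<and> b \<in> C \<and> gen_less b a}"
    by auto
  moreover have "card \<dots> = card {(a, b). a \<in> A \<and> b \<in> C \<and> gen_less b a}
      + card {(a, b). a \<in> B \<and> b \<in> C \<and> gen_less b a}"
    using assms by (intro card_Un_disjoint finite_inversions) auto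
  ultimately show ?thesis by (simp add: shuffle_sign_def power_add)
qed

lemma shuffle_sign_Un_right:
  assumes "finite A" "finite B" "finite C" "B \<inter> C = {}"
  shows "shuffle_sign A (B \<union> C) = shuffle_sign A B * shuffle_sign A C"
proof -
  have "{(a, b). a \<in> A \<and> b \<in> B \<union> C \<and> gen_less b a}
      = {(a, b). a \<in> A \<and> b \<in> B \<and> gen_less b a} \<union> {(a, b). a \<in> A \<and> b \<in> C \<and> gen_less b a}"
    by auto
  moreover have "card \<dots> = card {(a, b). a \<in> A \<and> b \<in> B \<and> gen_less b a}
      + card {(a, b). a \<in> A \<and> b \<in> C \<and> gen_less b a}"
    using assms by (intro card_Un_disjoint finite_inversions) auto
  ultimately show ?thesis by (simp add: shuffle_sign_def power_add)
qed

lemma shuffle_sign_swap: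
  assumes "a \<noteq> b" shows "shuffle_sign {b} {a} = - shuffle_sign {a} {b}"
proof -
  have "{(x, y). x \<in> {a} \<and> y \<in> {b} \<and> gen_less y x} = (if gen_less b a then {(a, b)} else {})" for a b :: 'a
    by auto
  then show ?thesis using gen_less_linear[OF assms] by (simp add: shuffle_sign_def)
qed

lemma shuffle_sign_insert_right:
  "finite B \<Longrightarrow> b \<notin> B \<Longrightarrow> shuffle_sign {a} (insert b B) = shuffle_sign {a} {b} * shuffle_sign {a} B"
  using shuffle_sign_Un_right[of "{a}" "{b}" B] by simp

typedef 'g grassmann = "{f :: 'g set \<Rightarrow> real. finite {A. f A \<noteq> 0} \<and> (\<forall>A. f A \<noteq> 0 \<longrightarrow> finite A)}"
  morphisms gcoeff Abs_grassmann
  by (rule exI[of _ "\<lambda>_. 0"]) simp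

setup_lifting type_definition_grassmann

lemma gcoeff_infinite [simp]: "infinite A \<Longrightarrow> gcoeff x A = 0"
  using gcoeff[of x] by auto

lemma finite_gcoeff: "finite {A. gcoeff x A \<noteq> 0}"
  using gcoeff[of x] by auto

lemma grassmann_eqI:
  assumes "\<And>A. finite A \<Longrightarrow> gcoeff x A = gcoeff y A"
  shows "x = y"
proof -
  have "gcoeff x A = gcoeff y A" for A
    by (cases "finite A") (simp_all add: assms)
  then show ?thesis by (simp add: ext flip: gcoeff_inject)
qed

instantiation grassmann :: (type) real_vector
begin

lift_definition zero_grassmann :: "'a grassmann" is "\<lambda>_. 0" by simp

lift_definition plus_grassmann :: "'a grassmann \<Rightarrow> 'a grassmann \<Rightarrow> 'a grassmann" is "\<lambda>f g A. f A + g A"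
proof (intro conjI allI impI)
  fix f g :: "'a set \<Rightarrow> real"
  assume f: "finite {A. f A \<noteq> 0} \<and> (\<forall>A. f A \<noteq> 0 \<longrightarrow> finite A)"
    and g: "finite {A. g A \<noteq> 0} \<and> (\<forall>A. g A \<noteq> 0 \<longrightarrow> finite A)"
  show "finite {A. f A + g A \<noteq> 0}"
    by (rule finite_subset[of _ "{A. f A \<noteq> 0} \<union> {A. g A \<noteq> 0}"]) (use f g in auto)
  show "finite A" if "f A + g A \<noteq> 0" for A
    using f g that by (cases "f A = 0"; cases "g A = 0") auto
qed

lift_definition uminus_grassmann :: "'a grassmann \<Rightarrow> 'a grassmann" is "\<lambda>f A. - f A" by simp

lift_definition minus_grassmann :: "'a grassmann \<Rightarrow> 'a grassmann \<Rightarrow> 'a grassmann" is "\<lambda>f g A. f A - g A"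
proof (intro conjI allI impI)
  fix f g :: "'a set \<Rightarrow> real"
  assume f: "finite {A. f A \<noteq> 0} \<and> (\<forall>A. f A \<noteq> 0 \<longrightarrow> finite A)"
    and g: "finite {A. g A \<noteq> 0} \<and> (\<forall>A. g A \<noteq> 0 \<longrightarrow> finite A)"
  show "finite {A. f A - g A \<noteq> 0}"
    by (rule finite_subset[of _ "{A. f A \<noteq> 0} \<union> {A. g A \<noteq> 0}"]) (use f g in auto)
  show "finite A" if "f A - g A \<noteq> 0" for A
    using f g that by (cases "f A = 0"; cases "g A = 0") auto
qed

lift_definition scaleR_grassmann :: "real \<Rightarrow> 'a grassmann \<Rightarrow> 'a grassmann" is "\<lambda>c f A. c * f A"
  by (auto intro: finite_subset)

instance
  by standard (transfer; simp add: fun_eq_iff algebra_simps)+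

end

instantiation grassmann :: (type) "{one, times}"
begin

lift_definition one_grassmann :: "'a grassmann" is "\<lambda>A. if A = {} then 1 else 0" by simp

lift_definition times_grassmann :: "'a grassmann \<Rightarrow> 'a grassmann \<Rightarrow> 'a grassmann"
  is "\<lambda>f g A. \<Sum>B\<in>Pow A. shuffle_sign B (A - B) * f B * g (A - B)"
proof -
  fix f g :: "'a set \<Rightarrow> real"
  assume f: "finite {A. f A \<noteq> 0} \<and> (\<forall>A. f A \<noteq> 0 \<longrightarrow> finite A)"
    and g: "finite {A. g A \<noteq> 0} \<and> (\<forall>A. g A \<noteq> 0 \<longrightarrow> finite A)"
  let ?h = "\<lambda>A. \<Sum>B\<in>Pow A. shuffle_sign B (A - B) * f B * g (A - B)"
  have *: "\<exists>B\<subseteq>A. f B \<noteq> 0 \<and> g (A - B) \<noteq> 0" if "?h A \<noteq> 0" for A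
    using that by (rule contrapos_np) (auto intro!: sum.neutral)
  have "{A. ?h A \<noteq> 0} \<subseteq> (\<lambda>(B, C). B \<union> C) ` ({A. f A \<noteq> 0} \<times> {A. g A \<noteq> 0})"
  proof
    fix A assume "A \<in> {A. ?h A \<noteq> 0}"
    then obtain B where "B \<subseteq> A" "f B \<noteq> 0" "g (A - B) \<noteq> 0" using * by blast
    then show "A \<in> (\<lambda>(B, C). B \<union> C) ` ({A. f A \<noteq> 0} \<times> {A. g A \<noteq> 0})"
      by (intro image_eqI[of _ _ "(B, A - B)"]) auto
  qed
  moreover have "finite ((\<lambda>(B, C). B \<union> C) ` ({A. f A \<noteq> 0} \<times> {A. g A \<noteq> 0}))"
    using f g by simp
  ultimately have "finite {A. ?h A \<noteq> 0}"
    by (rule finite_subset)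
  moreover have "finite A" if "?h A \<noteq> 0" for A
    using that by (rule contrapos_np) simp
  ultimately show "finite {A. ?h A \<noteq> 0} \<and> (\<forall>A. ?h A \<noteq> 0 \<longrightarrow> finite A)"
    by simp
qed

instance ..

end

lemma gcoeff_simps [simp]:
  "gcoeff 0 A = 0" "gcoeff (x + y) A = gcoeff x A + gcoeff y A" "gcoeff (- x) A = - gcoeff x A"
  "gcoeff (x - y) A = gcoeff x A - gcoeff y A" "gcoeff (c *\<^sub>R x) A = c * gcoeff x A"
  "gcoeff 1 A = (if A = {} then 1 else 0)"
  by (transfer; simp)+

lemma gcoeff_times: "gcoeff (x * y) A = (\<Sum>B\<in>Pow A. shuffle_sign B (A - B) * gcoeff x B * gcoeff y (A - B))"
  by transfer simp

instance grassmann :: (type) real_algebra_1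
proof
  fix x y z :: "'a grassmann" and c :: real
  show "x * y * z = x * (y * z)"
  proof (rule grassmann_eqI)
    fix A :: "'a set" assume A: "finite A"
    let ?t = "\<lambda>C D R. shuffle_sign C D * shuffle_sign C R * shuffle_sign D R * gcoeff x C * gcoeff y D * gcoeff z R"
    have fin: "finite B" if "B \<subseteq> A" for B using A that finite_subset by auto
    have "gcoeff (x * y * z) A = (\<Sum>B\<in>Pow A. \<Sum>C\<in>Pow B. ?t C (B - C) (A - B))"
      unfolding gcoeff_times sum_distrib_left sum_distrib_right
    proof (intro sum.cong refl)
      fix B C assume "B \<in> Pow A" "C \<in> Pow B"
      then have "C \<union> (B - C) = B" "finite C" "finite (B - C)" "finite (A - B)"
        using A fin[of B] finite_subset[of C B] by auto
      then have "shuffle_sign B (A - B) = shuffle_sign C (A - B) * shuffle_sign (B - C) (A - B)"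
        using shuffle_sign_Un_left[of C "B - C" "A - B"] by auto
      then show "shuffle_sign B (A - B) * (shuffle_sign C (B - C) * gcoeff x C * gcoeff y (B - C)) * gcoeff z (A - B)
          = ?t C (B - C) (A - B)"
        by simp
    qed
    also have "\<dots> = (\<Sum>(B, C)\<in>Sigma (Pow A) Pow. ?t C (B - C) (A - B))"
      using A fin by (subst sum.Sigma) auto
    also have "\<dots> = (\<Sum>(C, D)\<in>Sigma (Pow A) (\<lambda>C. Pow (A - C)). ?t C D (A - C - D))"
    proof (rule sum.reindex_bij_witness[where i = "\<lambda>(C, D). (C \<union> D, C)" and j = "\<lambda>(B, C). (C, B - C)"], goal_cases)
      case (5 p)
      then have "A - snd p - (fst p - snd p) = A - fst p" by auto
      then show ?case by (simp add: case_prod_beta)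
    qed (clarsimp; blast)+
    also have "\<dots> = (\<Sum>C\<in>Pow A. \<Sum>D\<in>Pow (A - C). ?t C D (A - C - D))"
      using A fin by (subst sum.Sigma) auto
    also have "\<dots> = gcoeff (x * (y * z)) A"
      unfolding gcoeff_times sum_distrib_left sum_distrib_right
    proof (intro sum.cong refl)
      fix C D assume "C \<in> Pow A" "D \<in> Pow (A - C)"
      then have "D \<union> (A - C - D) = A - C" "finite C" "finite D" "finite (A - C - D)"
        using A fin[of C] finite_subset[of D A] by auto
      then have "shuffle_sign C (A - C) = shuffle_sign C D * shuffle_sign C (A - C - D)"
        using shuffle_sign_Un_right[of C D "A - C - D"] by auto
      then show "?t C D (A - C - D) = shuffle_sign C (A - C) * gcoeff x C *
          (shuffle_sign D (A - C - D) * gcoeff y D * gcoeff z (A - C - D))"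
        by simp
    qed
    finally show "gcoeff (x * y * z) A = gcoeff (x * (y * z)) A" .
  qed
  show "(x + y) * z = x * z + y * z" "x * (y + z) = x * y + x * z"
    "(c *\<^sub>R x) * y = c *\<^sub>R (x * y)" "x * (c *\<^sub>R y) = c *\<^sub>R (x * y)"
    by (rule grassmann_eqI; simp add: gcoeff_times algebra_simps sum.distrib sum_distrib_left)+
  show "1 * x = x"
  proof (rule grassmann_eqI)
    fix A :: "'a set" assume "finite A"
    then have "gcoeff (1 * x) A = (\<Sum>B\<in>{{}}. shuffle_sign B (A - B) * gcoeff 1 B * gcoeff x (A - B))"
      unfolding gcoeff_times by (intro sum.mono_neutral_right) auto
    then show "gcoeff (1 * x) A = gcoeff x A" by simp
  qed
  show "x * 1 = x"
  proof (rule grassmann_eqI)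
    fix A :: "'a set" assume A: "finite A"
    have "gcoeff 1 (A - B) = 0" if "B \<in> Pow A - {A}" for B
      using that by (subst gcoeff_simps) auto
    then have "gcoeff (x * 1) A = (\<Sum>B\<in>{A}. shuffle_sign B (A - B) * gcoeff x B * gcoeff 1 (A - B))"
      unfolding gcoeff_times using A by (intro sum.mono_neutral_right) simp_all
    then show "gcoeff (x * 1) A = gcoeff x A" by simp
  qed
  show "(0 :: 'a grassmann) \<noteq> 1"
  proof
    assume "(0 :: 'a grassmann) = 1"
    then have "gcoeff (0 :: 'a grassmann) {} = gcoeff (1 :: 'a grassmann) {}" by (simp only:)
    then show False by simp
  qed
qed

lift_definition gen :: "'g \<Rightarrow> 'g grassmann" is "\<lambda>g A. if A = {g} then 1 else 0" by simp

lemma gcoeff_gen [simp]: "gcoeff (gen g) A = (if A = {g} then 1 else 0)"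
  by transfer simp

lemma gcoeff_gen_times:
  "gcoeff (gen g * x) A = (if g \<in> A then shuffle_sign {g} (A - {g}) * gcoeff x (A - {g}) else 0)"
proof (cases "finite A")
  case True
  then have "gcoeff (gen g * x) A = (\<Sum>B\<in>(if g \<in> A then {{g}} else {}).
      shuffle_sign B (A - B) * gcoeff (gen g) B * gcoeff x (A - B))"
    unfolding gcoeff_times by (intro sum.mono_neutral_right) (auto split: if_splits)
  then show ?thesis by simp
qed simp

lemma gen_anticommute: "gen a * gen b = - (gen b * gen a)"
proof (cases "a = b")
  case True
  then have "gen a * gen b = 0" by (intro grassmann_eqI) (auto simp: gcoeff_gen_times)
  with True show ?thesis by simp
next
  case False
  then have *: "A - {a} = {b} \<and> a \<in> A \<longleftrightarrow> A = {a, b}" "A - {b} = {a} \<and> b \<in> A \<longleftrightarrow> A = {a, b}" for A by auto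
  then show ?thesis
    using False shuffle_sign_swap[OF False]
    by (intro grassmann_eqI) (auto simp: gcoeff_gen_times insert_Diff_if)
qed

lift_definition left_deriv :: "'g \<Rightarrow> 'g grassmann \<Rightarrow> 'g grassmann"
  is "\<lambda>g f A. if g \<in> A then 0 else shuffle_sign {g} A * f (insert g A)"
proof -
  fix g :: 'g and f :: "'g set \<Rightarrow> real"
  assume f: "finite {A. f A \<noteq> 0} \<and> (\<forall>A. f A \<noteq> 0 \<longrightarrow> finite A)"
  let ?h = "\<lambda>A. if g \<in> A then 0 else shuffle_sign {g} A * f (insert g A)"
  have "{A. ?h A \<noteq> 0} \<subseteq> (\<lambda>A. A - {g}) ` {A. f A \<noteq> 0}"
  proof
    fix A assume "A \<in> {A. ?h A \<noteq> 0}"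
    then show "A \<in> (\<lambda>A. A - {g}) ` {A. f A \<noteq> 0}"
      by (intro image_eqI[of _ _ "insert g A"]) (auto split: if_splits)
  qed
  moreover have "finite ((\<lambda>A. A - {g}) ` {A. f A \<noteq> 0})"
    using f by simp
  ultimately have "finite {A. ?h A \<noteq> 0}"
    by (rule finite_subset)
  moreover have "finite A" if "?h A \<noteq> 0" for A
  proof -
    have "f (insert g A) \<noteq> 0" using that by (auto split: if_splits)
    then have "finite (insert g A)" by (rule f[THEN conjunct2, rule_format])
    then show ?thesis by simp
  qed
  ultimately show "finite {A. ?h A \<noteq> 0} \<and> (\<forall>A. ?h A \<noteq> 0 \<longrightarrow> finite A)"
    by simp
qed

lemma gcoeff_left_deriv:
  "gcoeff (left_deriv g x) A = (if g \<in> A then 0 else shuffle_sign {g} A * gcoeff x (insert g A))"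
  by transfer simp

definition not_involving :: "'g \<Rightarrow> 'g grassmann \<Rightarrow> bool" where
  "not_involving g x \<longleftrightarrow> (\<forall>A. g \<in> A \<longrightarrow> gcoeff x A = 0)"

lemma linear_left_deriv: "linear (left_deriv g)"
  by (intro linearI grassmann_eqI) (auto simp: gcoeff_left_deriv algebra_simps)

lemma left_deriv_gen_times: "not_involving g x \<Longrightarrow> left_deriv g (gen g * x) = x"
  by (intro grassmann_eqI)
     (auto simp: gcoeff_left_deriv gcoeff_gen_times not_involving_def simp flip: mult.assoc)

lemma left_deriv_eq_0: "not_involving g x \<Longrightarrow> left_deriv g x = 0"
  by (intro grassmann_eqI) (auto simp: gcoeff_left_deriv not_involving_def)

text \<open>Every element is \<open>g * P + Q\<close> with \<open>P\<close>, \<open>Q\<close> not involving \<open>g\<close>, so the three preceding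
  facts determine the left derivative.\<close>

lemma left_deriv_decomposition:
  obtains P Q where "x = gen g * P + Q" "not_involving g P" "not_involving g Q"
proof
  let ?P = "left_deriv g x"
  show "x = gen g * ?P + (x - gen g * ?P)" by simp
  show "not_involving g ?P" by (simp add: not_involving_def gcoeff_left_deriv)
  show "not_involving g (x - gen g * ?P)"
    by (auto simp: not_involving_def gcoeff_left_deriv gcoeff_gen_times insert_absorb simp flip: mult.assoc)
qed

lemma left_deriv_anticommute: "left_deriv a (left_deriv b x) = - left_deriv b (left_deriv a x)"
proof (rule grassmann_eqI)
  fix A :: "'a set" assume A: "finite A"
  show "gcoeff (left_deriv a (left_deriv b x)) A = gcoeff (- left_deriv b (left_deriv a x)) A"
  proof (cases "a = b \<or> a \<in> A \<or> b \<in> A")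
    case True
    then show ?thesis by (auto simp: gcoeff_left_deriv)
  next
    case False
    then have "gcoeff (left_deriv a (left_deriv b x)) A
        = shuffle_sign {a} A * (shuffle_sign {b} {a} * shuffle_sign {b} A) * gcoeff x (insert b (insert a A))"
      and "gcoeff (left_deriv b (left_deriv a x)) A
        = shuffle_sign {b} A * (shuffle_sign {a} {b} * shuffle_sign {a} A) * gcoeff x (insert a (insert b A))"
      using A by (auto simp: gcoeff_left_deriv shuffle_sign_insert_right[of A])
    moreover have "insert a (insert b A) = insert b (insert a A)" by (rule insert_commute)
    ultimately show ?thesis
      using False shuffle_sign_swap[of a b] by simp
  qed
qed

text \<open>The exponential series of an element without scalar part, of which only finitely many terms
  are nonzero.\<close>

definition grassmann_exp :: "'g grassmann \<Rightarrow> 'g grassmann" where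
  "grassmann_exp x = (\<Sum>n | x ^ n \<noteq> 0. (1 / fact n) *\<^sub>R x ^ n)"

lemma gcoeff_times_nonzero:
  assumes "gcoeff (x * y) A \<noteq> 0"
  obtains B where "B \<subseteq> A" "gcoeff x B \<noteq> 0" "gcoeff y (A - B) \<noteq> 0"
proof -
  have "\<exists>B\<in>Pow A. shuffle_sign B (A - B) * gcoeff x B * gcoeff y (A - B) \<noteq> 0"
    using assms unfolding gcoeff_times by (meson sum.neutral)
  then show ?thesis using that by auto
qed

lemma finite_nonzero_powers:
  assumes "gcoeff x {} = 0"
  shows "finite {n. x ^ n \<noteq> 0}"
proof -
  let ?U = "\<Union> {A. gcoeff x A \<noteq> 0}"
  have U: "finite ?U"
    using finite_gcoeff[of x] by (rule finite_Union) (auto intro: ccontr)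
  have *: "gcoeff (x ^ n) A \<noteq> 0 \<Longrightarrow> A \<subseteq> ?U \<and> n \<le> card A" for n A
  proof (induction n arbitrary: A)
    case 0
    then show ?case by (simp split: if_splits)
  next
    case (Suc n)
    from Suc.prems have "gcoeff (x * x ^ n) A \<noteq> 0" by simp
    then obtain B where B: "B \<subseteq> A" "gcoeff x B \<noteq> 0" "gcoeff (x ^ n) (A - B) \<noteq> 0"
      by (rule gcoeff_times_nonzero)
    have IH: "A - B \<subseteq> ?U" "n \<le> card (A - B)" using Suc.IH[OF B(3)] by auto
    have "B \<subseteq> ?U" using B(2) by blast
    then have "A \<subseteq> ?U" using IH(1) B(1) by auto
    then have "finite A" using U by (rule finite_subset)
    moreover have "B \<noteq> {}" using B(2) assms by auto
    ultimately have "card (A - B) < card A" using B(1) by (intro psubset_card_mono) auto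
    with \<open>A \<subseteq> ?U\<close> IH(2) show ?case by simp
  qed
  have "n \<le> card ?U" if "x ^ n \<noteq> 0" for n
  proof -
    have "\<exists>A. gcoeff (x ^ n) A \<noteq> 0"
    proof (rule ccontr)
      assume "\<not> (\<exists>A. gcoeff (x ^ n) A \<noteq> 0)"
      then have "x ^ n = 0" by (intro grassmann_eqI) simp
      with that show False by simp
    qed
    then obtain A where "gcoeff (x ^ n) A \<noteq> 0" ..
    with * have "A \<subseteq> ?U" "n \<le> card A" by auto
    moreover have "card A \<le> card ?U" using U \<open>A \<subseteq> ?U\<close> by (rule card_mono)
    ultimately show ?thesis by simp
  qed
  then have "{n. x ^ n \<noteq> 0} \<subseteq> {..card ?U}" by auto
  then show ?thesis by (rule finite_subset) simp
qed


section \<open>Determinants over a finite index set\<close>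

definition set_det :: "'i set \<Rightarrow> ('i \<Rightarrow> 'i \<Rightarrow> real) \<Rightarrow> real" where
  "set_det I A = (\<Sum>p | p permutes I. of_int (sign p) * (\<Prod>i\<in>I. A i (p i)))"

lemma set_det_eq_det:
  assumes "distinct xs"
  shows "set_det (set xs) A
    = Determinant.det (Matrix.mat (length xs) (length xs) (\<lambda>(i, j). A (xs ! i) (xs ! j)))"
proof -
  let ?n = "length xs" and ?f = "(!) xs"
  let ?m = "map_permutation {0..<?n} ?f" and ?g = "inv_into {0..<?n} ?f"
  let ?m' = "map_permutation (set xs) ?g"
  have bij: "bij_betw ?f {0..<?n} (set xs)"
    using bij_betw_nth[OF assms, of "{0..<?n}" "set xs"] by (simp add: lessThan_atLeast0)
  then have inj: "inj_on ?f {0..<?n}" by (rule bij_betw_imp_inj_on)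
  have bij': "bij_betw ?g (set xs) {0..<?n}" using bij by (rule bij_betw_inv_into)
  have "Determinant.det (Matrix.mat ?n ?n (\<lambda>(i, j). A (xs ! i) (xs ! j)))
      = (\<Sum>p | p permutes {0..<?n}. of_int (sign p) * (\<Prod>i = 0..<?n. A (xs ! i) (xs ! p i)))"
    unfolding Determinant.det_def
    by (auto intro!: sum.cong prod.cong simp: permutes_in_image)
  also have "\<dots> = (\<Sum>p | p permutes set xs. of_int (sign p) * (\<Prod>i\<in>set xs. A i (p i)))"
  proof (rule sum.reindex_bij_witness[where i = ?m' and j = ?m], goal_cases)
    case (1 p)
    then show ?case
      using map_permutation_compose_inv[OF bij, of p ?g] inj by simp
  next
    case (2 p)
    then show ?case using map_permutation_permutes[OF bij, of p] by simp
  next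
    case (3 p)
    then show ?case
      using map_permutation_compose_inv[OF bij', of p ?f] bij_betw_inv_into_right[OF bij] by simp
  next
    case (4 p)
    then show ?case using map_permutation_permutes[OF bij', of p] by simp
  next
    case (5 p)
    have "(\<Prod>i\<in>set xs. A i (?m p i)) = (\<Prod>i = 0..<?n. A (xs ! i) (?m p (xs ! i)))"
      by (rule prod.reindex_bij_betw[OF bij, symmetric])
    also have "\<dots> = (\<Prod>i = 0..<?n. A (xs ! i) (xs ! p i))"
      by (intro prod.cong refl) (simp add: map_permutation_apply[OF inj])
    finally show ?case
      using 5 by (simp add: sign_map_permutation[OF inj])
  qed
  finally show ?thesis by (simp add: set_det_def)
qed


section \<open>Graphs and spanning trees\<close>

definition simple_graph :: "'v set \<Rightarrow> ('v \<Rightarrow> 'v \<Rightarrow> bool) \<Rightarrow> bool" where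
  "simple_graph V adj \<longleftrightarrow> (\<forall>u v. adj u v \<longrightarrow> u \<in> V \<and> v \<in> V \<and> u \<noteq> v \<and> adj v u)"

definition connected_graph :: "'v set \<Rightarrow> ('v \<Rightarrow> 'v \<Rightarrow> bool) \<Rightarrow> bool" where
  "connected_graph V adj \<longleftrightarrow> (\<forall>u\<in>V. \<forall>v\<in>V. adj\<^sup>*\<^sup>* u v)"

definition locally_finite_graph :: "'v set \<Rightarrow> ('v \<Rightarrow> 'v \<Rightarrow> bool) \<Rightarrow> bool" where
  "locally_finite_graph V adj \<longleftrightarrow> (\<forall>v\<in>V. finite {w. adj v w})"

definition edges_touching :: "('v \<Rightarrow> 'v \<Rightarrow> bool) \<Rightarrow> 'v set \<Rightarrow> 'v set set" where
  "edges_touching adj \<Lambda> = {{u, v} | u v. adj u v \<and> (u \<in> \<Lambda> \<or> v \<in> \<Lambda>)}"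

definition orientation :: "'v set set \<Rightarrow> ('v set \<Rightarrow> 'v) \<Rightarrow> ('v set \<Rightarrow> 'v) \<Rightarrow> bool" where
  "orientation E tail tip \<longleftrightarrow> (\<forall>e\<in>E. e = {tail e, tip e})"

text \<open>
  A multigraph has vertex set \<open>W\<close>, edge set \<open>E\<close>, and a map \<open>ends\<close> sending an edge to its set of end
  vertices (a singleton for a loop). Since \<open>es\<close> is distinct in the following definition, two parallel
  edges form a cycle of length 2, but an edge traversed back and forth does not.
\<close>

definition mg_cycle :: "('e \<Rightarrow> 'w set) \<Rightarrow> 'e set \<Rightarrow> 'w list \<Rightarrow> 'e list \<Rightarrow> bool" where
  "mg_cycle ends T ws es \<longleftrightarrow>
     es \<noteq> [] \<and> length ws = length es \<and> distinct ws \<and> distinct es \<and> set es \<subseteq> T \<and>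
     (\<forall>i < length es. ends (es ! i) = {ws ! i, ws ! (Suc i mod length es)})"

definition mg_connected :: "'w set \<Rightarrow> ('e \<Rightarrow> 'w set) \<Rightarrow> 'e set \<Rightarrow> bool" where
  "mg_connected W ends T \<longleftrightarrow> (\<forall>x\<in>W. \<forall>y\<in>W. (\<lambda>a b. \<exists>e\<in>T. ends e = {a, b})\<^sup>*\<^sup>* x y)"

definition spanning_tree :: "'w set \<Rightarrow> 'e set \<Rightarrow> ('e \<Rightarrow> 'w set) \<Rightarrow> 'e set \<Rightarrow> bool" where
  "spanning_tree W E ends T \<longleftrightarrow>
     T \<subseteq> E \<and> mg_connected W ends T \<and> \<not> (\<exists>ws es. mg_cycle ends T ws es)"

text \<open>In the wired graph, \<open>None\<close> is the vertex obtained by identifying all vertices outside \<open>\<Lambda>\<close>.\<close>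

definition wire :: "'v set \<Rightarrow> 'v \<Rightarrow> 'v option" where
  "wire \<Lambda> v = (if v \<in> \<Lambda> then Some v else None)"

definition wired_spanning_trees :: "('v \<Rightarrow> 'v \<Rightarrow> bool) \<Rightarrow> 'v set \<Rightarrow> 'v set set set" where
  "wired_spanning_trees adj \<Lambda> =
     {T. spanning_tree (insert None (Some ` \<Lambda>)) (edges_touching adj \<Lambda>) (\<lambda>e. wire \<Lambda> ` e) T}"

definition UST :: "('v \<Rightarrow> 'v \<Rightarrow> bool) \<Rightarrow> 'v set \<Rightarrow> 'v set set pmf" where
  "UST adj \<Lambda> = pmf_of_set (wired_spanning_trees adj \<Lambda>)"


section \<open>Laplacian, Green's function and transfer-current matrix\<close>

text \<open>\<open>\<Delta>\<^sub>\<Lambda>\<close> is the restriction of the following function to \<open>\<Lambda> \<times> \<Lambda>\<close>.\<close>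

definition laplacian :: "('v \<Rightarrow> 'v \<Rightarrow> bool) \<Rightarrow> 'v \<Rightarrow> 'v \<Rightarrow> real" where
  "laplacian adj u v = (if u = v then - real (card {w. adj u w}) else if adj u v then 1 else 0)"

definition is_green :: "('v \<Rightarrow> 'v \<Rightarrow> bool) \<Rightarrow> 'v set \<Rightarrow> ('v \<Rightarrow> 'v \<Rightarrow> real) \<Rightarrow> bool" where
  "is_green adj \<Lambda> g \<longleftrightarrow>
     (\<forall>u\<in>\<Lambda>. \<forall>v\<in>\<Lambda>. (\<Sum>w\<in>\<Lambda>. - laplacian adj u w * g w v) = (if u = v then 1 else 0)) \<and>
     (\<forall>u\<in>\<Lambda>. \<forall>v\<in>\<Lambda>. (\<Sum>w\<in>\<Lambda>. g u w * - laplacian adj w v) = (if u = v then 1 else 0)) \<and>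
     (\<forall>u v. u \<notin> \<Lambda> \<or> v \<notin> \<Lambda> \<longrightarrow> g u v = 0)"

definition green :: "('v \<Rightarrow> 'v \<Rightarrow> bool) \<Rightarrow> 'v set \<Rightarrow> 'v \<Rightarrow> 'v \<Rightarrow> real" where
  "green adj \<Lambda> = (THE g. is_green adj \<Lambda> g)"

lemma is_green_unique:
  assumes "finite \<Lambda>" "is_green adj \<Lambda> g" "is_green adj \<Lambda> h"
  shows "g = h"
proof (intro ext)
  fix u v
  show "g u v = h u v"
  proof (cases "u \<in> \<Lambda> \<and> v \<in> \<Lambda>")
    case True
    let ?A = "\<lambda>u v. - laplacian adj u v"
    have "g u v = (\<Sum>w\<in>\<Lambda>. g u w * (if w = v then 1 else 0))"
      using True assms(1) by (simp add: if_distrib cong: if_cong)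
    also have "\<dots> = (\<Sum>w\<in>\<Lambda>. g u w * (\<Sum>x\<in>\<Lambda>. ?A w x * h x v))"
      using True assms(3) by (intro sum.cong) (auto simp: is_green_def)
    also have "\<dots> = (\<Sum>x\<in>\<Lambda>. (\<Sum>w\<in>\<Lambda>. g u w * ?A w x) * h x v)"
      by (simp only: sum_distrib_left sum_distrib_right mult.assoc) (rule sum.swap)
    also have "\<dots> = (\<Sum>x\<in>\<Lambda>. (if u = x then 1 else 0) * h x v)"
      using True assms(2) by (intro sum.cong) (auto simp: is_green_def)
    also have "\<dots> = h u v"
      using True assms(1) by (simp add: if_distrib if_distribR cong: if_cong)
    finally show ?thesis .
  qed (use assms in \<open>auto simp: is_green_def\<close>)
qed

definition transfer_current ::
  "('v \<Rightarrow> 'v \<Rightarrow> bool) \<Rightarrow> 'v set \<Rightarrow> ('v set \<Rightarrow> 'v) \<Rightarrow> ('v set \<Rightarrow> 'v) \<Rightarrow> 'v set \<Rightarrow> 'v set \<Rightarrow> real" where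
  "transfer_current adj \<Lambda> tail tip f g =
     green adj \<Lambda> (tip f) (tip g) - green adj \<Lambda> (tip f) (tail g)
     - green adj \<Lambda> (tail f) (tip g) + green adj \<Lambda> (tail f) (tail g)"


section \<open>The fermionic Gaussian free field\<close>

datatype 'v fermion = Psi 'v | PsiBar 'v

text \<open>
  \<open>\<Omega>\<^sup>2\<^sup>\<Lambda>\<close> is the subalgebra of the Grassmann algebra on all \<open>\<psi>\<^sub>v\<close>, \<open>\<psi>\<^sub>v\<close>-bar whose elements involve
  only the generators with \<open>v \<in> \<Lambda>\<close>.
\<close>

definition Omega2 :: "'v set \<Rightarrow> 'v fermion grassmann set" where
  "Omega2 \<Lambda> = {P. \<forall>A. gcoeff P A \<noteq> 0 \<longrightarrow> A \<subseteq> Psi ` \<Lambda> \<union> PsiBar ` \<Lambda>}"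

definition psi :: "'v set \<Rightarrow> 'v \<Rightarrow> 'v fermion grassmann" where
  "psi \<Lambda> v = (if v \<in> \<Lambda> then gen (Psi v) else 0)"

definition psibar :: "'v set \<Rightarrow> 'v \<Rightarrow> 'v fermion grassmann" where
  "psibar \<Lambda> v = (if v \<in> \<Lambda> then gen (PsiBar v) else 0)"

definition zeta :: "'v set \<Rightarrow> ('v set \<Rightarrow> 'v) \<Rightarrow> ('v set \<Rightarrow> 'v) \<Rightarrow> 'v set \<Rightarrow> 'v fermion grassmann" where
  "zeta \<Lambda> tail tip e =
     (psi \<Lambda> (tip e) - psi \<Lambda> (tail e)) * (psibar \<Lambda> (tip e) - psibar \<Lambda> (tail e))"

definition pair_deriv :: "'v \<Rightarrow> 'v fermion grassmann \<Rightarrow> 'v fermion grassmann" where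
  "pair_deriv v P = left_deriv (PsiBar v) (left_deriv (Psi v) P)"

text \<open>The operator \<open>\<Prod>v\<in>\<Lambda>. pair_deriv v\<close>, with composition as product; the factors commute.\<close>

definition pair_derivs :: "'v set \<Rightarrow> 'v fermion grassmann \<Rightarrow> 'v fermion grassmann" where
  "pair_derivs \<Lambda> P = Finite_Set.fold pair_deriv P \<Lambda>"

text \<open>On \<open>\<Omega>\<^sup>2\<^sup>\<Lambda>\<close> the image of \<open>pair_derivs\<close> consists of scalars, which are read off as the
  coefficient of the empty monomial.\<close>

definition fermion_state :: "('v \<Rightarrow> 'v \<Rightarrow> bool) \<Rightarrow> 'v set \<Rightarrow> 'v fermion grassmann \<Rightarrow> real" where
  "fermion_state adj \<Lambda> P =
     1 / set_det \<Lambda> (\<lambda>u v. - laplacian adj u v) *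
     gcoeff (pair_derivs \<Lambda>
       (grassmann_exp (\<Sum>u\<in>\<Lambda>. \<Sum>v\<in>\<Lambda>. (- laplacian adj u v) *\<^sub>R (psi \<Lambda> u * psibar \<Lambda> v)) * P)) {}"

interpretation pair_deriv: comp_fun_commute pair_deriv
proof
  fix u v :: 'a
  have swap: "left_deriv a (pair_deriv v P) = pair_deriv v (left_deriv a P)" for a v and P :: "'a fermion grassmann"
    unfolding pair_deriv_def
    by (simp add: left_deriv_anticommute[of a "PsiBar v"] left_deriv_anticommute[of a "Psi v"]
        linear_neg[OF linear_left_deriv])
  show "pair_deriv v \<circ> pair_deriv u = pair_deriv u \<circ> pair_deriv v"
    by (rule ext) (simp add: swap pair_deriv_def[of v])
qed

lemma pair_derivs_scalar:
  assumes "finite \<Lambda>" "P \<in> Omega2 \<Lambda>"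
  shows "pair_derivs \<Lambda> P = of_real (gcoeff (pair_derivs \<Lambda> P) {})"
proof -
  have "gcoeff (Finite_Set.fold pair_deriv P S) A \<noteq> 0 \<Longrightarrow> A \<subseteq> Psi ` (\<Lambda> - S) \<union> PsiBar ` (\<Lambda> - S)"
    if "finite S" for S A
    using that
  proof (induction S arbitrary: A)
    case empty
    then show ?case using assms(2) by (auto simp: Omega2_def)
  next
    case (insert v S)
    let ?Q = "Finite_Set.fold pair_deriv P S"
    from insert.prems insert.hyps have *: "gcoeff (pair_deriv v ?Q) A \<noteq> 0" by simp
    then have **: "gcoeff ?Q (insert (Psi v) (insert (PsiBar v) A)) \<noteq> 0" "Psi v \<notin> A" "PsiBar v \<notin> A"
      by (auto simp: pair_deriv_def gcoeff_left_deriv split: if_splits)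
    from insert.IH[OF **(1)] **(2,3) show ?case by blast
  qed
  from this[OF assms(1)] have *: "gcoeff (pair_derivs \<Lambda> P) A = 0" if "A \<noteq> {}" for A
    using that by (auto simp: pair_derivs_def)
  show ?thesis
    by (rule grassmann_eqI) (auto simp: of_real_def *)
qed

lemma zeta_commute: "zeta \<Lambda> tail tip e * zeta \<Lambda> tail tip f = zeta \<Lambda> tail tip f * zeta \<Lambda> tail tip e"
proof -
  have quad: "(a * b) * (c * d) = (c * d) * (a * b)"
    if "a * c = - (c * a)" "a * d = - (d * a)" "b * c = - (c * b)" "b * d = - (d * b)"
    for a b c d :: "'a fermion grassmann"
  proof -
    have "(a * b) * (c * d) = a * (b * c) * d" by (simp add: mult.assoc)
    also have "\<dots> = - ((a * c) * (b * d))" by (simp add: that(3) mult.assoc)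
    also have "\<dots> = - (c * (a * d) * b)" by (simp add: that(1,4) mult.assoc)
    also have "\<dots> = (c * d) * (a * b)" by (simp add: that(2) mult.assoc)
    finally show ?thesis .
  qed
  have anti: "a * b = - (b * a)" if "a \<in> range (psi \<Lambda>) \<union> range (psibar \<Lambda>)" "b \<in> range (psi \<Lambda>) \<union> range (psibar \<Lambda>)"
    for a b :: "'a fermion grassmann"
    using that gen_anticommute by (auto simp: psi_def psibar_def)
  show ?thesis
    unfolding zeta_def
    by (intro quad; simp only: left_diff_distrib right_diff_distrib minus_diff_eq;
        subst (1 2 3 4) anti; simp)
qed

end

theory Submission
  imports Defs
begin

text \<open>
  Since \<open>-\<Delta>\<^sub>\<Lambda>\<close> is the sum of the rank-one matrices \<open>b\<^sub>e b\<^sub>e\<^sup>T\<close> over the edges, where \<open>b\<^sub>e\<close> is the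
  incidence vector of \<open>e\<close>, the Gaussian weight is \<open>exp (\<Sum>e. \<zeta>(e))\<close>, and multiplying it by
  \<open>\<Prod>e. (1 + x\<^sub>e \<zeta>(e))\<close> changes the edge weights from \<open>1\<close> to \<open>1 + x\<^sub>e\<close>. The Grassmann integral of
  the result is \<open>det (-\<Delta>\<^sub>\<Lambda> + \<Sum>e. x\<^sub>e b\<^sub>e b\<^sub>e\<^sup>T)\<close>. Expanding the product over the edges shows that it is
  a weighted count of spanning trees, while \<open>det (1 + U V) = det (1 + V U)\<close> turns its quotient by
  \<open>det (-\<Delta>\<^sub>\<Lambda>)\<close> into \<open>det (1 + x M)\<close>. The choice \<open>x\<^sub>g = -1\<close> gives the factors for \<open>G\<close>. The factor
  \<open>\<zeta>(f)\<close> is not of the form \<open>1 + x \<zeta>(f)\<close>, but all three quantities extend to functions of factors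
  \<open>a\<^sub>e + x\<^sub>e \<zeta>(e)\<close> that are linear in each pair \<open>(a\<^sub>e, x\<^sub>e)\<close>, so agreement at \<open>a = 1\<close> suffices.
\<close>

section \<open>Elements of degree one\<close>

text \<open>The Grassmann algebra is not commutative, so products over edges or vertices are list
  products, and factors are rearranged only through elements of \<open>quad\<close>, which commute
  pairwise and square to zero. Hence \<open>exp q = 1 + q\<close> for such \<open>q\<close>, and
  \<open>(1 + zeta) * (1 + x zeta) = 1 + (1 + x) zeta\<close>; this is the reason why a factor
  changes an edge weight. One exponent can be grouped by the rows of its matrix, which gives the
  Leibniz formula, or by edges, which gives the Cauchy--Binet formula; the integral keeps only the
  top degree, and this fixes the number of edges in a surviving term. That a tree contributes
  exactly 1 is an integrality argument instead of an induction on leaves. The same argument supplies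
  the edge count of a tree, and the existence of a tree makes the Laplacian invertible. Only the
  unperturbed Laplacian is ever inverted, so the choice -1, which may delete enough edges to make
  the perturbed matrix singular, needs no separate treatment.\<close>

lemma span_gen_anticommute:
  assumes "x \<in> span (range gen)" "y \<in> span (range gen)"
  shows "x * y = - (y * x :: 'g grassmann)"
proof -
  have gen: "gen a * y = - (y * gen a)" if "y \<in> span (range gen)" for a and y :: "'g grassmann"
    using that
  proof (induction rule: span_induct_alt)
    case (step c b y)
    then show ?case using gen_anticommute[of a] by (auto simp: algebra_simps)
  qed simp
  from assms(1) show ?thesis
  proof (induction rule: span_induct_alt)
    case (step c b x)
    then show ?case using gen[OF assms(2)] by (auto simp: algebra_simps)
  qed simp
qed

lemma span_gen_square:
  assumes "x \<in> span (range gen)"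
  shows "x * x = (0 :: 'g grassmann)"
proof -
  have "x * x + x * x = 0"
    using span_gen_anticommute[OF assms assms] by (metis add.right_inverse)
  then have "2 *\<^sub>R (x * x) = 0" by (simp only: scaleR_2)
  then show ?thesis by simp
qed

text \<open>Only single products, not their linear span: sums of such products still commute, but
  \<open>q * q = 0\<close> already fails for a sum of two products in independent
  generators.\<close>

definition quad :: "'g grassmann set" where
  "quad = {x * y | x y. x \<in> span (range gen) \<and> y \<in> span (range gen)}"

lemma quadI: "x \<in> span (range gen) \<Longrightarrow> y \<in> span (range gen) \<Longrightarrow> x * y \<in> quad"
  by (auto simp: quad_def)

lemma quad_scaleR: "q \<in> quad \<Longrightarrow> c *\<^sub>R q \<in> quad"
  unfolding quad_def by (smt (verit) mem_Collect_eq mult_scaleR_left span_scale)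

text \<open>Interchanging two pairs of odd elements takes four sign changes.\<close>

lemma quad_commute:
  assumes "p \<in> quad" "q \<in> quad"
  shows "p * q = q * p"
proof -
  obtain a b c d where *: "p = a * b" "q = c * d"
      "a \<in> span (range gen)" "b \<in> span (range gen)" "c \<in> span (range gen)" "d \<in> span (range gen)"
    using assms by (auto simp: quad_def)
  note anti = span_gen_anticommute
  have "(a * b) * (c * d) = a * (b * c) * d" by (simp add: mult.assoc)
  also have "\<dots> = - ((a * c) * (b * d))" using anti[of b c] * by (simp add: mult.assoc)
  also have "\<dots> = - (c * (a * d) * b)" using anti[of a c] anti[of b d] * by (simp add: mult.assoc)
  also have "\<dots> = (c * d) * (a * b)" using anti[of a d] * by (simp add: mult.assoc)
  finally show ?thesis using * by simp
qed

lemma quad_square: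
  assumes "p \<in> quad"
  shows "p * p = 0"
proof -
  obtain a b where *: "p = a * b" "a \<in> span (range gen)" "b \<in> span (range gen)"
    using assms by (auto simp: quad_def)
  have "(a * b) * (a * b) = a * (b * a) * b" by (simp add: mult.assoc)
  also have "\<dots> = - ((a * a) * (b * b))" using span_gen_anticommute[of b a] * by (simp add: mult.assoc)
  finally show ?thesis using * by (simp add: span_gen_square)
qed

text \<open>Degree in the monomial basis; \<open>0\<close> is homogeneous of every degree. The
  integral sees only degree \<open>2 * card \<Lambda>\<close>, so the degree controls how many edges
  a surviving product has.\<close>

definition homogeneous :: "nat \<Rightarrow> 'g grassmann \<Rightarrow> bool" where
  "homogeneous k x \<longleftrightarrow> (\<forall>A. gcoeff x A \<noteq> 0 \<longrightarrow> card A = k)"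

lemma homogeneous_times:
  assumes "homogeneous j x" "homogeneous k y"
  shows "homogeneous (j + k) (x * y)"
  unfolding homogeneous_def
proof (intro allI impI)
  fix A assume A: "gcoeff (x * y) A \<noteq> 0"
  then obtain B where B: "B \<subseteq> A" "gcoeff x B \<noteq> 0" "gcoeff y (A - B) \<noteq> 0"
    by (rule gcoeff_times_nonzero)
  have "finite A" using A by (rule contrapos_np) simp
  then have "card A = card B + card (A - B)"
    using B(1) by (metis card_Diff_subset card_mono finite_subset le_add_diff_inverse)
  with B assms show "card A = j + k" by (simp add: homogeneous_def)
qed

lemma homogeneous_span_gen:
  assumes "x \<in> span (range gen)"
  shows "homogeneous 1 x"
  using assms
proof (induction rule: span_induct_alt)
  case base
  then show ?case by (simp add: homogeneous_def)
next
  case (step c b x)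
  then show ?case
    by (auto simp: homogeneous_def split: if_splits)
qed

lemma homogeneous_quad: "q \<in> quad \<Longrightarrow> homogeneous 2 q"
  using homogeneous_times[of 1 _ 1] homogeneous_span_gen by (fastforce simp: quad_def numeral_2_eq_2)

lemma gcoeff_quad_empty: "q \<in> quad \<Longrightarrow> gcoeff q {} = 0"
  using homogeneous_quad by (force simp: homogeneous_def)

lemma homogeneous_prod_list_quad:
  "(\<And>e. e \<in> set es \<Longrightarrow> q e \<in> quad) \<Longrightarrow> homogeneous (2 * length es) (\<Prod>e\<leftarrow>es. q e)"
proof (induction es)
  case Nil
  then show ?case by (simp add: homogeneous_def)
next
  case (Cons e es)
  then show ?case
    using homogeneous_times[OF homogeneous_quad[of "q e"], of "2 * length es"] by simp
qed

section \<open>Products and exponentials of quadratic elements\<close>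

lemma commute_prod_list:
  fixes x :: "'a :: monoid_mult"
  shows "(\<And>e. e \<in> set es \<Longrightarrow> x * f e = f e * x) \<Longrightarrow> x * (\<Prod>e\<leftarrow>es. f e) = (\<Prod>e\<leftarrow>es. f e) * x"
proof (induction es)
  case (Cons e es)
  have "x * (f e * (\<Prod>e\<leftarrow>es. f e)) = f e * (x * (\<Prod>e\<leftarrow>es. f e))"
    using Cons.prems[of e] by (metis list.set_intros(1) mult.assoc)
  also have "\<dots> = f e * (\<Prod>e\<leftarrow>es. f e) * x"
    using Cons by (simp add: mult.assoc)
  finally show ?case by simp
qed simp

lemma prod_list_remove1:
  fixes f :: "'b \<Rightarrow> 'a :: monoid_mult"
  assumes "\<And>d e. d \<in> set es \<Longrightarrow> e \<in> set es \<Longrightarrow> f d * f e = f e * f d" "d \<in> set es"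
  shows "(\<Prod>e\<leftarrow>es. f e) = f d * (\<Prod>e\<leftarrow>remove1 d es. f e)"
proof -
  obtain xs ys where es: "es = xs @ d # ys" "d \<notin> set xs"
    using assms(2) by (meson split_list_first)
  have "f d * (\<Prod>e\<leftarrow>xs. f e) = (\<Prod>e\<leftarrow>xs. f e) * f d"
    using assms(1) es by (intro commute_prod_list) auto
  then show ?thesis using es by (simp add: remove1_append flip: mult.assoc)
qed

text \<open>\<open>filter\<close> keeps the factors of each subset in the order of
  \<open>es\<close>, so the expansion is valid in a noncommutative ring.\<close>

lemma prod_list_one_plus:
  fixes q :: "'b \<Rightarrow> 'a :: ring_1"
  assumes "distinct es"
  shows "(\<Prod>e\<leftarrow>es. 1 + q e) = (\<Sum>T\<in>Pow (set es). \<Prod>e\<leftarrow>filter (\<lambda>e. e \<in> T) es. q e)"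
  using assms
proof (induction es)
  case (Cons e es)
  let ?F = "\<lambda>es T. \<Prod>e\<leftarrow>filter (\<lambda>e. e \<in> T) es. q e"
  have *: "?F (e # es) T = ?F es T" "?F (e # es) (insert e T) = q e * ?F es T" if "T \<subseteq> set es" for T
  proof -
    show "?F (e # es) T = ?F es T" using that Cons.prems by auto
    have "filter (\<lambda>d. d \<in> insert e T) es = filter (\<lambda>d. d \<in> T) es"
      using Cons.prems by (intro filter_cong) auto
    then show "?F (e # es) (insert e T) = q e * ?F es T" by simp
  qed
  have inj: "inj_on (insert e) (Pow (set es))"
    using Cons.prems by (auto simp: inj_on_def)
  have "(\<Sum>T\<in>Pow (set (e # es)). ?F (e # es) T)
      = (\<Sum>T\<in>Pow (set es). ?F (e # es) T) + (\<Sum>T\<in>insert e ` Pow (set es). ?F (e # es) T)"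
    unfolding list.set Pow_insert using Cons.prems by (intro sum.union_disjoint) auto
  also have "(\<Sum>T\<in>insert e ` Pow (set es). ?F (e # es) T) = (\<Sum>T\<in>Pow (set es). q e * ?F es T)"
    unfolding sum.reindex[OF inj] comp_def by (intro sum.cong refl *) simp
  also have "(\<Sum>T\<in>Pow (set es). ?F (e # es) T) = (\<Sum>T\<in>Pow (set es). ?F es T)"
    by (intro sum.cong refl *) simp
  finally show ?case using Cons by (simp add: distrib_right sum_distrib_left sum.distrib)
qed simp

text \<open>Extensional functions list each choice of one summand per factor exactly once.\<close>

lemma prod_list_sum_PiE:
  fixes h :: "'b \<Rightarrow> 'c \<Rightarrow> 'a :: ring_1"
  assumes "distinct us" "finite S"
  shows "(\<Prod>u\<leftarrow>us. \<Sum>v\<in>S. h u v) = (\<Sum>p\<in>Pi\<^sub>E (set us) (\<lambda>_. S). \<Prod>u\<leftarrow>us. h u (p u))"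
  using assms(1)
proof (induction us)
  case (Cons u us)
  have "(\<Sum>p\<in>Pi\<^sub>E (set (u # us)) (\<lambda>_. S). \<Prod>u\<leftarrow>u # us. h u (p u))
      = (\<Sum>(v, p)\<in>S \<times> Pi\<^sub>E (set us) (\<lambda>_. S). \<Prod>w\<leftarrow>u # us. h w ((p(u := v)) w))"
    unfolding list.set(2) PiE_insert_eq
    by (subst sum.reindex) (use Cons.prems inj_combinator[of u "set us" "\<lambda>_. S"] in \<open>auto simp: case_prod_beta\<close>)
  also have "\<dots> = (\<Sum>(v, p)\<in>S \<times> Pi\<^sub>E (set us) (\<lambda>_. S). h u v * (\<Prod>w\<leftarrow>us. h w (p w)))"
    using Cons.prems by (intro sum.cong) (auto intro!: arg_cong2[where f = "(*)"] arg_cong[where f = prod_list])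
  also have "\<dots> = (\<Sum>v\<in>S. h u v) * (\<Sum>p\<in>Pi\<^sub>E (set us) (\<lambda>_. S). \<Prod>w\<leftarrow>us. h w (p w))"
    by (simp add: sum_product sum.cartesian_product)
  finally show ?case using Cons by simp
qed simp

section \<open>Exponentials of nilpotent elements\<close>

lemma grassmann_exp_finite:
  assumes "finite N" "{n. x ^ n \<noteq> 0} \<subseteq> N"
  shows "grassmann_exp x = (\<Sum>n\<in>N. (1 / fact n) *\<^sub>R x ^ n)"
  unfolding grassmann_exp_def using assms by (intro sum.mono_neutral_left) auto

lemma grassmann_exp_0 [simp]: "grassmann_exp 0 = 1"
proof -
  have "grassmann_exp (0 :: 'a grassmann) = (\<Sum>n\<in>{0}. (1 / fact n) *\<^sub>R 0 ^ n)"
    by (rule grassmann_exp_finite) (auto simp: power_0_left)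
  then show ?thesis by simp
qed

text \<open>The binomial theorem stops after the term linear in \<open>y\<close>; the exponent
  \<open>Suc n\<close> avoids a predecessor in \<open>x ^ n\<close>.\<close>

lemma power_add_square_zero:
  fixes x y :: "'a :: real_algebra_1"
  assumes "x * y = y * x" "y * y = 0"
  shows "(x + y) ^ Suc n = x ^ Suc n + real (Suc n) *\<^sub>R (x ^ n * y)"
proof (induction n)
  case (Suc n)
  have yx: "y * x ^ k = x ^ k * y" for k
    using assms(1) by (metis power_commuting_commutes)
  have yxy: "y * (x ^ n * y) = 0"
    using yx[of n] assms(2) by (metis mult.assoc mult_zero_right)
  have "(x + y) ^ Suc (Suc n) = (x + y) * (x ^ Suc n + real (Suc n) *\<^sub>R (x ^ n * y))"
    using Suc.IH by simp
  also have "\<dots> = x * x ^ Suc n + y * x ^ Suc n + real (Suc n) *\<^sub>R (x * (x ^ n * y))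
      + real (Suc n) *\<^sub>R (y * (x ^ n * y))"
    by (simp only: distrib_right distrib_left mult_scaleR_right scaleR_add_right add.assoc add.left_commute)
  also have "\<dots> = x ^ Suc (Suc n) + real (Suc (Suc n)) *\<^sub>R (x ^ Suc n * y)"
    unfolding yx yxy by (simp add: mult.assoc scaleR_left_distrib scaleR_2)
  finally show ?case .
qed simp

lemma grassmann_exp_add:
  assumes "x * y = y * x" "y * y = 0" "gcoeff x {} = 0" "gcoeff y {} = 0"
  shows "grassmann_exp (x + y) = grassmann_exp x * (1 + y)"
proof -
  have fin: "finite ({n. x ^ n \<noteq> 0} \<union> {n. (x + y) ^ n \<noteq> 0})"
    using finite_nonzero_powers[of x] finite_nonzero_powers[of "x + y"] assms(3,4) by simp
  then obtain N where N: "\<And>n. n \<in> {n. x ^ n \<noteq> 0} \<union> {n. (x + y) ^ n \<noteq> 0} \<Longrightarrow> n < N"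
    by (meson finite_nat_set_iff_bounded)
  \<comment> \<open>By definition the series of different elements run over different index sets, so
    a common cut-off is imposed. The terms with \<open>y\<close> lose one power of \<open>x\<close>
    to an index shift; hence the series of \<open>x\<close> is needed with \<open>Suc N\<close> and
    with \<open>N\<close> terms.\<close>
  have exp: "grassmann_exp (x + y) = (\<Sum>n<Suc N. (1 / fact n) *\<^sub>R (x + y) ^ n)"
    "grassmann_exp x = (\<Sum>n<Suc N. (1 / fact n) *\<^sub>R x ^ n)"
    "grassmann_exp x = (\<Sum>n<N. (1 / fact n) *\<^sub>R x ^ n)"
    by (rule grassmann_exp_finite, simp, use N in \<open>force intro: less_SucI\<close>)+
  have "(\<Sum>n<Suc N. (1 / fact n) *\<^sub>R (x + y) ^ n)
      = 1 + (\<Sum>n<N. (1 / fact (Suc n)) *\<^sub>R (x ^ Suc n + real (Suc n) *\<^sub>R (x ^ n * y)))"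
    by (simp add: sum.lessThan_Suc_shift power_add_square_zero[OF assms(1,2)] del: power_Suc fact_Suc sum.lessThan_Suc of_nat_Suc)
  also have "\<dots> = 1 + (\<Sum>n<N. (1 / fact (Suc n)) *\<^sub>R x ^ Suc n) + (\<Sum>n<N. (1 / fact n) *\<^sub>R (x ^ n * y))"
    by (simp add: scaleR_add_right sum.distrib del: power_Suc)
  also have "1 + (\<Sum>n<N. (1 / fact (Suc n)) *\<^sub>R x ^ Suc n) = grassmann_exp x"
    unfolding exp(2) by (simp add: sum.lessThan_Suc_shift del: power_Suc fact_Suc sum.lessThan_Suc)
  also have "(\<Sum>n<N. (1 / fact n) *\<^sub>R (x ^ n * y)) = grassmann_exp x * y"
    unfolding exp(3) by (simp add: sum_distrib_right)
  finally show ?thesis unfolding exp(1) by (simp add: distrib_left)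
qed

lemma gcoeff_sum: "gcoeff (sum f S) A = (\<Sum>e\<in>S. gcoeff (f e) A)"
  by (induction S rule: infinite_finite_induct) auto

text \<open>The exponent \<open>x\<close> accumulates the \<open>q e\<close>: commuting with all of
  \<open>quad\<close> survives this, while squaring to zero would not. Later \<open>x\<close> is the
  Gaussian quadratic form.\<close>

lemma grassmann_exp_add_quads:
  assumes "gcoeff x {} = 0" "\<And>e. e \<in> set es \<Longrightarrow> q e \<in> quad"
    and "\<And>p. p \<in> quad \<Longrightarrow> x * p = p * x"
  shows "grassmann_exp (x + (\<Sum>e\<leftarrow>es. q e)) = grassmann_exp x * (\<Prod>e\<leftarrow>es. 1 + q e)"
  using assms
proof (induction es arbitrary: x)
  case (Cons e es)
  have "grassmann_exp (x + (\<Sum>e\<leftarrow>e # es. q e)) = grassmann_exp ((x + q e) + (\<Sum>e\<leftarrow>es. q e))"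
    by (simp add: add.assoc)
  also have "\<dots> = grassmann_exp (x + q e) * (\<Prod>e\<leftarrow>es. 1 + q e)"
    using Cons.prems by (intro Cons.IH) (auto simp: gcoeff_quad_empty distrib_left distrib_right quad_commute)
  also have "grassmann_exp (x + q e) = grassmann_exp x * (1 + q e)"
    using Cons.prems by (intro grassmann_exp_add) (auto simp: gcoeff_quad_empty quad_square)
  finally show ?case by (simp add: mult.assoc)
qed simp

lemma grassmann_exp_sum_quad:
  assumes "distinct es" "\<And>e. e \<in> set es \<Longrightarrow> q e \<in> quad"
  shows "grassmann_exp (\<Sum>e\<in>set es. q e) = (\<Prod>e\<leftarrow>es. 1 + q e)"
  using grassmann_exp_add_quads[of 0 es q] assms by (simp add: sum_list_distinct_conv_sum_set)

section \<open>The Grassmann integral\<close>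

text \<open>The unnormalised Berezin integral: up to a sign, the coefficient of the monomial in all
  generators over \<open>\<Lambda>\<close>.\<close>

definition berezin :: "'v set \<Rightarrow> 'v fermion grassmann \<Rightarrow> real" where
  "berezin \<Lambda> P = gcoeff (pair_derivs \<Lambda> P) {}"

text \<open>Since the pair derivatives commute, a new one can act last, which suits inductions on
  the result, or first, which suits evaluating a product from its leading factor.\<close>

lemma pair_derivs_insert:
  "finite S \<Longrightarrow> v \<notin> S \<Longrightarrow> pair_derivs (insert v S) P = pair_deriv v (pair_derivs S P)"
  "finite S \<Longrightarrow> v \<notin> S \<Longrightarrow> pair_derivs (insert v S) P = pair_derivs S (pair_deriv v P)"
  unfolding pair_derivs_def by (simp, metis pair_deriv.fold_insert2)

lemma linear_pair_derivs:
  assumes "finite S"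
  shows "linear (pair_derivs S)"
  using assms
proof induction
  case empty
  then show ?case by (intro linearI) (simp_all add: pair_derivs_def)
next
  case (insert v S)
  have "linear (pair_deriv v)"
    unfolding pair_deriv_def
    using linear_compose[OF linear_left_deriv linear_left_deriv] by (simp add: comp_def)
  then show ?case
    using linear_compose[OF insert.IH \<open>linear (pair_deriv v)\<close>] insert.hyps
    by (simp add: comp_def pair_derivs_insert(1))
qed

lemma linear_berezin: "finite \<Lambda> \<Longrightarrow> linear (berezin \<Lambda>)"
  using linear_pair_derivs[of \<Lambda>]
  by (intro linearI) (simp_all add: berezin_def linear_add linear_scale)

text \<open>The set \<open>A\<close> varies in the induction, because undoing the derivatives at
  \<open>v\<close> puts both generators of \<open>v\<close> back into the monomial. With
  \<open>A = {}\<close> only the top monomial is left.\<close>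

lemma gcoeff_pair_derivs_nonzero:
  assumes "finite S" "gcoeff (pair_derivs S P) A \<noteq> 0"
  shows "A \<inter> (Psi ` S \<union> PsiBar ` S) = {} \<and> gcoeff P (A \<union> (Psi ` S \<union> PsiBar ` S)) \<noteq> 0"
  using assms
proof (induction S arbitrary: A)
  case empty
  then show ?case by (simp add: pair_derivs_def)
next
  case (insert v S)
  let ?B = "insert (Psi v) (insert (PsiBar v) A)"
  from insert.prems insert.hyps
  have "gcoeff (pair_deriv v (pair_derivs S P)) A \<noteq> 0" by (simp add: pair_derivs_insert(1))
  then have *: "gcoeff (pair_derivs S P) ?B \<noteq> 0" "Psi v \<notin> A" "PsiBar v \<notin> A"
    by (auto simp: pair_deriv_def gcoeff_left_deriv split: if_splits)
  have "?B \<union> (Psi ` S \<union> PsiBar ` S) = A \<union> (Psi ` insert v S \<union> PsiBar ` insert v S)" by auto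
  with insert.IH[OF *(1)] * show ?case by auto
qed

lemma card_fermions: "finite \<Lambda> \<Longrightarrow> card (Psi ` \<Lambda> \<union> PsiBar ` \<Lambda>) = 2 * card \<Lambda>"
  by (subst card_Un_disjoint) (auto simp: card_image inj_on_def)

lemma berezin_homogeneous:
  assumes "finite \<Lambda>" "homogeneous k P" "k \<noteq> 2 * card \<Lambda>"
  shows "berezin \<Lambda> P = 0"
proof (rule ccontr)
  assume "berezin \<Lambda> P \<noteq> 0"
  then have "gcoeff P (Psi ` \<Lambda> \<union> PsiBar ` \<Lambda>) \<noteq> 0"
    using gcoeff_pair_derivs_nonzero[OF assms(1), of P "{}"] by (simp add: berezin_def)
  with assms card_fermions[OF assms(1)] show False by (auto simp: homogeneous_def)
qed

lemma gcoeff_quad_gens_subset: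
  "gcoeff (\<Prod>u\<leftarrow>us. gen (Psi u) * gen (PsiBar u)) A \<noteq> 0 \<Longrightarrow> A \<subseteq> Psi ` set us \<union> PsiBar ` set us"
proof (induction us arbitrary: A)
  case (Cons u us)
  then have "PsiBar u \<in> A - {Psi u}" "gcoeff (\<Prod>u\<leftarrow>us. gen (Psi u) * gen (PsiBar u)) (A - {Psi u} - {PsiBar u}) \<noteq> 0"
    by (auto simp: mult.assoc gcoeff_gen_times split: if_splits)
  from Cons.IH[OF this(2)] show ?case by auto
qed (simp split: if_splits)

text \<open>No sign appears: the derivative in \<open>Psi v\<close> acts first and
  \<open>Psi v\<close> stands in front; its removal brings \<open>PsiBar v\<close> to the front.
  This makes the integral of the product of all pairs equal to \<open>+1\<close>.\<close>

lemma pair_deriv_gens_times: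
  assumes "not_involving (Psi v) Q" "not_involving (PsiBar v) Q"
  shows "pair_deriv v (gen (Psi v) * gen (PsiBar v) * Q) = Q"
proof -
  have "not_involving (Psi v) (gen (PsiBar v) * Q)"
    using assms(1) by (auto simp: not_involving_def gcoeff_gen_times)
  then show ?thesis
    using assms(2) by (simp add: pair_deriv_def mult.assoc left_deriv_gen_times)
qed

lemma berezin_gens:
  "distinct us \<Longrightarrow> berezin (set us) (\<Prod>u\<leftarrow>us. gen (Psi u) * gen (PsiBar u)) = 1"
proof (induction us)
  case Nil
  then show ?case by (simp add: berezin_def pair_derivs_def)
next
  case (Cons v us)
  let ?Q = "\<Prod>u\<leftarrow>us. gen (Psi u) * gen (PsiBar u)"
  have "not_involving (Psi v) ?Q" "not_involving (PsiBar v) ?Q"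
    using gcoeff_quad_gens_subset[of us] Cons.prems unfolding not_involving_def by fastforce+
  then have "pair_derivs (set (v # us)) (gen (Psi v) * gen (PsiBar v) * ?Q) = pair_derivs (set us) ?Q"
    using Cons.prems by (simp add: pair_derivs_insert(2) pair_deriv_gens_times)
  with Cons show ?case by (simp add: berezin_def)
qed

text \<open>Once the factors of \<open>a\<close> and \<open>b\<close> are at the front, exchanging
  \<open>y a\<close> with \<open>y b\<close> amounts to reversing \<open>y b * x b * y a\<close>,
  which takes three transpositions.\<close>

lemma prod_list_quad_transpose:
  assumes "distinct us" "a \<in> set us" "b \<in> set us" "a \<noteq> b"
    and span: "\<And>u. x u \<in> span (range gen)" "\<And>u. y u \<in> span (range gen)"
  shows "(\<Prod>u\<leftarrow>us. x u * y (Transposition.transpose a b u)) = - (\<Prod>u\<leftarrow>us. x u * y u)"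
proof -
  define rest where "rest = remove1 b (remove1 a us)"
  have split: "(\<Prod>u\<leftarrow>us. x u * z u) = (x a * z a) * ((x b * z b) * (\<Prod>u\<leftarrow>rest. x u * z u))"
    if "\<And>u. z u \<in> span (range gen)" for z
  proof -
    have comm: "(x d * z d) * (x e * z e) = (x e * z e) * (x d * z d)" for d e
      using that span(1) by (intro quad_commute quadI) auto
    have "b \<in> set (remove1 a us)" using assms by auto
    from prod_list_remove1[of "remove1 a us" "\<lambda>u. x u * z u", OF comm this]
      prod_list_remove1[of us "\<lambda>u. x u * z u", OF comm assms(2)]
    show ?thesis by (simp add: rest_def)
  qed
  have "(\<Prod>u\<leftarrow>rest. x u * y (Transposition.transpose a b u)) = (\<Prod>u\<leftarrow>rest. x u * y u)"
    using assms(1) by (intro arg_cong[where f = prod_list] map_cong) (auto simp: rest_def Transposition.transpose_def)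
  moreover have "(x a * y b) * (x b * y a) = - ((x a * y a) * (x b * y b))"
  proof -
    note anti = span_gen_anticommute
    have "(y b * x b) * y a = y b * - (y a * x b)" using anti[of "x b" "y a"] span by (simp add: mult.assoc)
    also have "\<dots> = - (y b * y a) * x b" by (simp add: mult.assoc)
    also have "\<dots> = y a * (y b * x b)" using anti[of "y b" "y a"] span by (simp add: mult.assoc)
    also have "\<dots> = - (y a * (x b * y b))" using anti[of "y b" "x b"] span by simp
    finally have "x a * ((y b * x b) * y a) = - (x a * (y a * (x b * y b)))" by simp
    then show ?thesis by (simp add: mult.assoc)
  qed
  ultimately show ?thesis
    using split[of y] split[of "\<lambda>u. y (Transposition.transpose a b u)"] span(2)
    by (simp flip: mult.assoc)
qed

lemma gen_in_span [simp]: "gen g \<in> span (range gen)"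
  by (rule span_base) simp

lemma berezin_permutation:
  assumes "distinct us" "p permutes set us"
  shows "berezin (set us) (\<Prod>u\<leftarrow>us. gen (Psi u) * gen (PsiBar (p u))) = of_int (sign p)"
  using finite_set assms(2)
proof (induction rule: permutes_rev_induct)
  case id
  then show ?case using berezin_gens[OF assms(1)] by simp
next
  \<comment> \<open>The reversed induction composes the transposition on the right, so it acts on
    the index \<open>u\<close> before \<open>p\<close>, the form that
    \<open>prod_list_quad_transpose\<close> expects.\<close>
  case (swap a b p)
  have "berezin (set us) (\<Prod>u\<leftarrow>us. gen (Psi u) * gen (PsiBar ((p \<circ> Transposition.transpose a b) u)))
      = - berezin (set us) (\<Prod>u\<leftarrow>us. gen (Psi u) * gen (PsiBar (p u)))"
    using prod_list_quad_transpose[OF assms(1) swap.hyps(1-3), of "\<lambda>u. gen (Psi u)" "\<lambda>u. gen (PsiBar (p u))"]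
    by (simp add: linear_neg[OF linear_berezin])
  moreover have "permutation p"
    using swap.hyps(4) permutes_imp_permutation[OF finite_set] by blast
  then have "sign (p \<circ> Transposition.transpose a b) = - sign p"
    unfolding sign_compose[OF \<open>permutation p\<close> permutation_swap_id] using swap.hyps(3)
    by (simp only: sign_swap_id if_False mult_minus_right mult_1_right)
  ultimately show ?case by (simp only: swap.IH of_int_minus)
qed

text \<open>Transposing two indices with the same image leaves the product unchanged and yet
  reverses its sign.\<close>

lemma berezin_not_inj:
  assumes "distinct us" "\<not> inj_on p (set us)"
  shows "berezin (set us) (\<Prod>u\<leftarrow>us. gen (Psi u) * gen (PsiBar (p u))) = 0"
proof -
  obtain a b where ab: "a \<in> set us" "b \<in> set us" "a \<noteq> b" "p a = p b"
    using assms(2) by (auto simp: inj_on_def)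
  let ?P = "\<Prod>u\<leftarrow>us. gen (Psi u) * gen (PsiBar (p u))"
  have "p (Transposition.transpose a b u) = p u" for u using ab(4) by (auto simp: Transposition.transpose_def)
  then have "?P = - ?P"
    using prod_list_quad_transpose[OF assms(1) ab(1-3), of "\<lambda>u. gen (Psi u)" "\<lambda>u. gen (PsiBar (p u))"] by simp
  then have "berezin (set us) ?P = berezin (set us) (- ?P)"
    by (rule arg_cong)
  then show ?thesis by (simp only: linear_neg[OF linear_berezin[OF finite_set]])
qed

text \<open>The term of \<open>T\<close> has degree \<open>2 * card T\<close>; comparison with the
  top degree gives the cardinality condition of the Cauchy--Binet formula.\<close>

lemma berezin_prod_list_one_plus_quad:
  assumes "finite \<Lambda>" "distinct es" "\<And>e. e \<in> set es \<Longrightarrow> q e \<in> quad"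
  shows "berezin \<Lambda> (\<Prod>e\<leftarrow>es. 1 + q e)
    = (\<Sum>T | T \<subseteq> set es \<and> card T = card \<Lambda>. berezin \<Lambda> (\<Prod>e\<leftarrow>filter (\<lambda>e. e \<in> T) es. q e))"
proof -
  have "berezin \<Lambda> (\<Prod>e\<leftarrow>filter (\<lambda>e. e \<in> T) es. q e) = 0" if "T \<subseteq> set es" "card T \<noteq> card \<Lambda>" for T
  proof -
    have "length (filter (\<lambda>e. e \<in> T) es) = card (set (filter (\<lambda>e. e \<in> T) es))"
      using assms(2) by (metis distinct_card distinct_filter)
    also have "set (filter (\<lambda>e. e \<in> T) es) = T" using that(1) by auto
    finally show ?thesis
      using that(2) assms(3) homogeneous_prod_list_quad[of "filter (\<lambda>e. e \<in> T) es" q]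
      by (intro berezin_homogeneous[OF assms(1)]) auto
  qed
  then show ?thesis
    unfolding prod_list_one_plus[OF assms(2)] linear_sum[OF linear_berezin[OF assms(1)]]
    by (intro sum.mono_neutral_right) auto
qed

lemma berezin_prod_list_scaleR:
  assumes "finite \<Lambda>"
  shows "berezin \<Lambda> (\<Prod>u\<leftarrow>us. c u *\<^sub>R h u) = (\<Prod>u\<leftarrow>us. c u) * berezin \<Lambda> (\<Prod>u\<leftarrow>us. h u)"
proof -
  have "(\<Prod>u\<leftarrow>us. c u *\<^sub>R h u) = (\<Prod>u\<leftarrow>us. c u) *\<^sub>R (\<Prod>u\<leftarrow>us. h u)"
    by (induction us) simp_all
  then show ?thesis by (simp add: linear_scale[OF linear_berezin[OF assms]])
qed

text \<open>Grouped by rows, the exponent has exactly \<open>card \<Lambda>\<close> summands in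
  \<open>quad\<close>, so only their full product reaches the top degree. Choosing a column in each
  row then gives the Leibniz sum, in which repeated columns vanish.\<close>

lemma berezin_exp:
  assumes "finite \<Lambda>"
  shows "berezin \<Lambda> (grassmann_exp (\<Sum>u\<in>\<Lambda>. \<Sum>v\<in>\<Lambda>. A u v *\<^sub>R (psi \<Lambda> u * psibar \<Lambda> v))) = set_det \<Lambda> A"
proof -
  obtain us where us: "set us = \<Lambda>" "distinct us"
    using finite_distinct_list[OF assms] by blast
  let ?q = "\<lambda>u. gen (Psi u) * (\<Sum>v\<in>\<Lambda>. A u v *\<^sub>R gen (PsiBar v))"
  let ?H = "\<lambda>p. \<Prod>u\<leftarrow>us. gen (Psi u) * gen (PsiBar (p u))"
  let ?Perm = "{p. p permutes \<Lambda>}"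
  have q: "?q u \<in> quad" for u by (intro quadI span_sum span_scale) auto
  have "(\<Sum>u\<in>\<Lambda>. \<Sum>v\<in>\<Lambda>. A u v *\<^sub>R (psi \<Lambda> u * psibar \<Lambda> v)) = (\<Sum>u\<in>set us. ?q u)"
    by (intro sum.cong) (simp_all add: us psi_def psibar_def sum_distrib_left)
  then have "berezin \<Lambda> (grassmann_exp (\<Sum>u\<in>\<Lambda>. \<Sum>v\<in>\<Lambda>. A u v *\<^sub>R (psi \<Lambda> u * psibar \<Lambda> v)))
      = berezin \<Lambda> (\<Prod>u\<leftarrow>us. 1 + ?q u)"
    by (simp only: grassmann_exp_sum_quad[OF us(2) q])
  also have "\<dots> = (\<Sum>T | T \<subseteq> set us \<and> card T = card \<Lambda>. berezin \<Lambda> (\<Prod>u\<leftarrow>filter (\<lambda>u. u \<in> T) us. ?q u))"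
    by (rule berezin_prod_list_one_plus_quad[OF assms us(2) q])
  also have "{T. T \<subseteq> set us \<and> card T = card \<Lambda>} = {\<Lambda>}"
    using us(1) card_subset_eq[OF assms] by auto
  also have "(\<Sum>T\<in>{\<Lambda>}. berezin \<Lambda> (\<Prod>u\<leftarrow>filter (\<lambda>u. u \<in> T) us. ?q u)) = berezin \<Lambda> (\<Prod>u\<leftarrow>us. ?q u)"
    by (simp add: us(1)[symmetric])
  also have "(\<Prod>u\<leftarrow>us. ?q u) = (\<Prod>u\<leftarrow>us. \<Sum>v\<in>\<Lambda>. A u v *\<^sub>R (gen (Psi u) * gen (PsiBar v)))"
    by (simp add: sum_distrib_left)
  also have "\<dots> = (\<Sum>p\<in>\<Lambda> \<rightarrow>\<^sub>E \<Lambda>. \<Prod>u\<leftarrow>us. A u (p u) *\<^sub>R (gen (Psi u) * gen (PsiBar (p u))))"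
    unfolding prod_list_sum_PiE[OF us(2) assms] us(1) ..
  also have "berezin \<Lambda> \<dots> = (\<Sum>p\<in>\<Lambda> \<rightarrow>\<^sub>E \<Lambda>. (\<Prod>u\<in>\<Lambda>. A u (p u)) * berezin \<Lambda> (?H p))"
    unfolding linear_sum[OF linear_berezin[OF assms]] berezin_prod_list_scaleR[OF assms]
    by (simp add: prod.distinct_set_conv_list[OF us(2)] flip: us(1))
  \<comment> \<open>A permutation in the sense of \<open>permutes\<close> is the identity off
    \<open>\<Lambda>\<close>, an extensional function is \<open>undefined\<close> there;
    \<open>restrict\<close> and \<open>restrict_id\<close> translate between the two.\<close>
  also have "\<dots> = (\<Sum>p\<in>(\<lambda>p. restrict p \<Lambda>) ` ?Perm. (\<Prod>u\<in>\<Lambda>. A u (p u)) * berezin \<Lambda> (?H p))"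
  proof (rule sum.mono_neutral_right)
    show "finite (\<Lambda> \<rightarrow>\<^sub>E \<Lambda>)" using assms by (simp add: finite_PiE)
    show "(\<lambda>p. restrict p \<Lambda>) ` ?Perm \<subseteq> \<Lambda> \<rightarrow>\<^sub>E \<Lambda>" by (auto simp: permutes_in_image)
    show "\<forall>p\<in>(\<Lambda> \<rightarrow>\<^sub>E \<Lambda>) - (\<lambda>p. restrict p \<Lambda>) ` ?Perm. (\<Prod>u\<in>\<Lambda>. A u (p u)) * berezin \<Lambda> (?H p) = 0"
    proof
      fix p assume p: "p \<in> (\<Lambda> \<rightarrow>\<^sub>E \<Lambda>) - (\<lambda>p. restrict p \<Lambda>) ` ?Perm"
      have "\<not> inj_on p \<Lambda>"
      proof
        assume "inj_on p \<Lambda>"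
        moreover have "p ` \<Lambda> \<subseteq> \<Lambda>" using p by auto
        ultimately have "bij_betw p \<Lambda> \<Lambda>" using assms by (simp add: bij_betw_def endo_inj_surj)
        then have "restrict_id p \<Lambda> permutes \<Lambda>" by (rule permutes_restrict_id)
        moreover have "p = restrict (restrict_id p \<Lambda>) \<Lambda>"
          using p by (intro ext) (auto simp: restrict_id_def PiE_def extensional_def)
        ultimately show False using p by auto
      qed
      then show "(\<Prod>u\<in>\<Lambda>. A u (p u)) * berezin \<Lambda> (?H p) = 0"
        using berezin_not_inj[OF us(2), of p] us(1) by simp
    qed
  qed
  also have "\<dots> = (\<Sum>p\<in>?Perm. (\<Prod>u\<in>\<Lambda>. A u (restrict p \<Lambda> u)) * berezin \<Lambda> (?H (restrict p \<Lambda>)))"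
  proof (subst sum.reindex)
    show "inj_on (\<lambda>p. restrict p \<Lambda>) ?Perm"
      by (intro inj_onI ext) (metis mem_Collect_eq permutes_def restrict_apply')
  qed simp
  also have "\<dots> = (\<Sum>p\<in>?Perm. of_int (sign p) * (\<Prod>u\<in>\<Lambda>. A u (p u)))"
  proof (intro sum.cong refl)
    fix p assume p: "p \<in> ?Perm"
    have "?H (restrict p \<Lambda>) = ?H p"
      using us(1) by (intro arg_cong[where f = prod_list] map_cong) auto
    then show "(\<Prod>u\<in>\<Lambda>. A u (restrict p \<Lambda> u)) * berezin \<Lambda> (?H (restrict p \<Lambda>))
        = of_int (sign p) * (\<Prod>u\<in>\<Lambda>. A u (p u))"
      using berezin_permutation[OF us(2), of p] p us(1) by simp
  qed
  finally show ?thesis by (simp add: set_det_def)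
qed

section \<open>The Cauchy--Binet formula and weighted partition functions\<close>

definition lin_psi :: "'v set \<Rightarrow> ('v \<Rightarrow> real) \<Rightarrow> 'v fermion grassmann" where
  "lin_psi \<Lambda> a = (\<Sum>u\<in>\<Lambda>. a u *\<^sub>R psi \<Lambda> u)"

definition lin_psibar :: "'v set \<Rightarrow> ('v \<Rightarrow> real) \<Rightarrow> 'v fermion grassmann" where
  "lin_psibar \<Lambda> a = (\<Sum>u\<in>\<Lambda>. a u *\<^sub>R psibar \<Lambda> u)"

lemma psi_in_span [simp]: "psi \<Lambda> u \<in> span (range gen)" "psibar \<Lambda> u \<in> span (range gen)"
  by (simp_all add: psi_def psibar_def span_zero)

lemma lin_psi_quad: "lin_psi \<Lambda> a * lin_psibar \<Lambda> b \<in> quad"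
  unfolding lin_psi_def lin_psibar_def by (intro quadI span_sum span_scale) simp_all

lemma sum_bilinear_form_eq:
  "(\<Sum>u\<in>\<Lambda>. \<Sum>v\<in>\<Lambda>. (\<Sum>e\<in>T. w e * a e u * b e v) *\<^sub>R (psi \<Lambda> u * psibar \<Lambda> v))
    = (\<Sum>e\<in>T. w e *\<^sub>R (lin_psi \<Lambda> (a e) * lin_psibar \<Lambda> (b e)))"
proof -
  have "w e *\<^sub>R (lin_psi \<Lambda> (a e) * lin_psibar \<Lambda> (b e))
      = (\<Sum>u\<in>\<Lambda>. \<Sum>v\<in>\<Lambda>. (w e * a e u * b e v) *\<^sub>R (psi \<Lambda> u * psibar \<Lambda> v))" for e
    by (simp add: lin_psi_def lin_psibar_def sum_product scaleR_sum_right mult_ac)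
  then show ?thesis
    by (simp add: scaleR_sum_left sum.swap[of _ T])
qed

text \<open>The exponent of \<open>berezin_exp\<close> once more, now grouped by the index
  \<open>e\<close> of the rank-one summands instead of by rows.\<close>

lemma set_det_sum_rank_one_eq_berezin:
  assumes "finite \<Lambda>" "distinct es"
  shows "set_det \<Lambda> (\<lambda>u v. \<Sum>e\<in>set es. w e * a e u * b e v)
    = berezin \<Lambda> (\<Prod>e\<leftarrow>es. 1 + w e *\<^sub>R (lin_psi \<Lambda> (a e) * lin_psibar \<Lambda> (b e)))"
  unfolding berezin_exp[OF assms(1), symmetric] sum_bilinear_form_eq
  by (subst grassmann_exp_sum_quad[OF assms(2)]) (simp_all add: quad_scaleR lin_psi_quad)

text \<open>The usual product of the minors of \<open>a\<close> and \<open>b\<close> on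
  \<open>T\<close> is kept as one determinant over \<open>\<Lambda>\<close>, which spares matching
  an order on \<open>T\<close> with one on \<open>\<Lambda>\<close>.\<close>

lemma set_det_Cauchy_Binet:
  assumes "finite \<Lambda>" "finite E"
  shows "set_det \<Lambda> (\<lambda>u v. \<Sum>e\<in>E. w e * a e u * b e v)
    = (\<Sum>T | T \<subseteq> E \<and> card T = card \<Lambda>. (\<Prod>e\<in>T. w e) * set_det \<Lambda> (\<lambda>u v. \<Sum>e\<in>T. a e u * b e v))"
proof -
  obtain es where es: "set es = E" "distinct es"
    using finite_distinct_list[OF assms(2)] by blast
  let ?q = "\<lambda>e. lin_psi \<Lambda> (a e) * lin_psibar \<Lambda> (b e)"
  let ?es = "\<lambda>T. filter (\<lambda>e. e \<in> T) es"
  have q: "c *\<^sub>R ?q e \<in> quad" for c e by (simp add: quad_scaleR lin_psi_quad)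
  have "set_det \<Lambda> (\<lambda>u v. \<Sum>e\<in>E. w e * a e u * b e v)
      = (\<Sum>T | T \<subseteq> E \<and> card T = card \<Lambda>. berezin \<Lambda> (\<Prod>e\<leftarrow>?es T. w e *\<^sub>R ?q e))"
    unfolding es(1)[symmetric] set_det_sum_rank_one_eq_berezin[OF assms(1) es(2)]
    by (rule berezin_prod_list_one_plus_quad[OF assms(1) es(2) q])
  also have "\<dots> = (\<Sum>T | T \<subseteq> E \<and> card T = card \<Lambda>. (\<Prod>e\<in>T. w e) * set_det \<Lambda> (\<lambda>u v. \<Sum>e\<in>T. a e u * b e v))"
  proof (intro sum.cong refl)
    fix T assume T: "T \<in> {T. T \<subseteq> E \<and> card T = card \<Lambda>}"
    have fin: "finite T" using T assms(2) finite_subset by auto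
    have esT: "set (?es T) = T" "distinct (?es T)" using T es by auto
    \<comment> \<open>Applied to \<open>T\<close> itself with unit weights, the expansion has the
      single term \<open>T\<close>; this identifies the integral that is left as a
      determinant.\<close>
    have "{S. S \<subseteq> set (?es T) \<and> card S = card \<Lambda>} = {T}"
      using T card_subset_eq[OF fin] unfolding esT(1) by auto
    then have "set_det \<Lambda> (\<lambda>u v. \<Sum>e\<in>T. a e u * b e v) = berezin \<Lambda> (\<Prod>e\<leftarrow>filter (\<lambda>e. e \<in> T) (?es T). 1 *\<^sub>R ?q e)"
      using set_det_sum_rank_one_eq_berezin[OF assms(1) esT(2), of "\<lambda>_. 1" a b]
        berezin_prod_list_one_plus_quad[OF assms(1) esT(2), of "\<lambda>e. 1 *\<^sub>R ?q e"] q[of 1]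
      unfolding esT(1) by simp
    then show "berezin \<Lambda> (\<Prod>e\<leftarrow>?es T. w e *\<^sub>R ?q e) = (\<Prod>e\<in>T. w e) * set_det \<Lambda> (\<lambda>u v. \<Sum>e\<in>T. a e u * b e v)"
      using prod.distinct_set_conv_list[OF esT(2), of w]
      unfolding berezin_prod_list_scaleR[OF assms(1)] esT(1) by (simp add: map_replicate_const)
  qed
  finally show ?thesis .
qed

section \<open>Incidence vectors and the perturbed state\<close>

definition incidence :: "('e \<Rightarrow> 'v) \<Rightarrow> ('e \<Rightarrow> 'v) \<Rightarrow> 'e \<Rightarrow> 'v \<Rightarrow> real" where
  "incidence tail tip e u = (if u = tip e then 1 else 0) - (if u = tail e then 1 else 0)"

lemma zeta_eq_lin:
  assumes "finite \<Lambda>"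
  shows "zeta \<Lambda> tail tip e = lin_psi \<Lambda> (incidence tail tip e) * lin_psibar \<Lambda> (incidence tail tip e)"
proof -
  have "(\<Sum>u\<in>\<Lambda>. incidence tail tip e u *\<^sub>R f u) = f (tip e) - f (tail e)"
    if "\<And>u. u \<notin> \<Lambda> \<Longrightarrow> f u = 0" for f :: "'a \<Rightarrow> 'a fermion grassmann"
  proof -
    have "(\<Sum>u\<in>\<Lambda>. (if u = w then 1 else 0 :: real) *\<^sub>R f u) = f w" for w
      using that assms by (simp add: if_distrib[of "\<lambda>c. c *\<^sub>R _"] cong: if_cong)
    then show ?thesis by (simp add: incidence_def scaleR_left_diff_distrib sum_subtractf)
  qed
  from this[of "psi \<Lambda>"] this[of "psibar \<Lambda>"] show ?thesis
    by (simp add: zeta_def lin_psi_def lin_psibar_def) (simp add: psi_def psibar_def)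
qed

text \<open>Both sides divide by the same determinant, so the identity can precede the matrix-tree
  theorem, which shows that this determinant is nonzero.\<close>

lemma fermion_state_prod_list:
  assumes "finite \<Lambda>" "distinct es"
  shows "fermion_state adj \<Lambda> (\<Prod>e\<leftarrow>es. 1 + x e *\<^sub>R zeta \<Lambda> tail tip e)
    = set_det \<Lambda> (\<lambda>u v. - laplacian adj u v
        + (\<Sum>e\<in>set es. x e * incidence tail tip e u * incidence tail tip e v))
      / set_det \<Lambda> (\<lambda>u v. - laplacian adj u v)"
proof -
  let ?Q = "\<Sum>u\<in>\<Lambda>. \<Sum>v\<in>\<Lambda>. (- laplacian adj u v) *\<^sub>R (psi \<Lambda> u * psibar \<Lambda> v)"
  let ?b = "incidence tail tip"
  let ?q = "\<lambda>e. x e *\<^sub>R zeta \<Lambda> tail tip e"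
  have q: "?q e \<in> quad" for e by (simp add: zeta_eq_lin[OF assms(1)] quad_scaleR lin_psi_quad)
  have Q: "(- laplacian adj u v) *\<^sub>R (psi \<Lambda> u * psibar \<Lambda> v) \<in> quad" for u v
    by (intro quad_scaleR quadI) simp_all
  have "grassmann_exp ?Q * (\<Prod>e\<leftarrow>es. 1 + ?q e) = grassmann_exp (?Q + (\<Sum>e\<leftarrow>es. ?q e))"
  proof (rule grassmann_exp_add_quads[symmetric])
    show "gcoeff ?Q {} = 0" by (simp only: gcoeff_sum gcoeff_quad_empty[OF Q] sum.neutral_const)
    show "?Q * p = p * ?Q" if "p \<in> quad" for p
      unfolding sum_distrib_left sum_distrib_right by (intro sum.cong refl quad_commute Q that)
  qed (rule q)
  also have "(\<Sum>e\<leftarrow>es. ?q e) = (\<Sum>u\<in>\<Lambda>. \<Sum>v\<in>\<Lambda>. (\<Sum>e\<in>set es. x e * ?b e u * ?b e v) *\<^sub>R (psi \<Lambda> u * psibar \<Lambda> v))"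
    using assms by (simp add: sum_bilinear_form_eq zeta_eq_lin sum_list_distinct_conv_sum_set)
  finally have "grassmann_exp ?Q * (\<Prod>e\<leftarrow>es. 1 + ?q e) = grassmann_exp
      (\<Sum>u\<in>\<Lambda>. \<Sum>v\<in>\<Lambda>. (- laplacian adj u v + (\<Sum>e\<in>set es. x e * ?b e u * ?b e v)) *\<^sub>R (psi \<Lambda> u * psibar \<Lambda> v))"
    by (simp only: scaleR_left_distrib sum.distrib)
  then show ?thesis
    by (simp only: fermion_state_def berezin_def[symmetric] berezin_exp[OF assms(1)]) simp
qed

section \<open>The wired Laplacian\<close>

lemma edges_touching_finite:
  assumes "simple_graph V adj" "locally_finite_graph V adj" "finite \<Lambda>" "\<Lambda> \<subseteq> V"
  shows "finite (edges_touching adj \<Lambda>)"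
proof (rule finite_subset)
  show "edges_touching adj \<Lambda> \<subseteq> (\<lambda>(u, v). {u, v}) ` (SIGMA u:\<Lambda>. {w. adj u w})"
    using assms(1) by (fastforce simp: edges_touching_def simple_graph_def)
  show "finite ((\<lambda>(u, v). {u, v}) ` (SIGMA u:\<Lambda>. {w. adj u w}))"
    using assms by (intro finite_imageI finite_SigmaI) (auto simp: locally_finite_graph_def)
qed

lemma orientation_adj:
  assumes "simple_graph V adj" "orientation (edges_touching adj \<Lambda>) tail tip" "e \<in> edges_touching adj \<Lambda>"
  shows "e = {tail e, tip e}" "adj (tail e) (tip e)" "tail e \<noteq> tip e" "tail e \<in> \<Lambda> \<or> tip e \<in> \<Lambda>"
proof -
  show e: "e = {tail e, tip e}" using assms by (auto simp: orientation_def)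
  obtain u v where uv: "e = {u, v}" "adj u v" "u \<in> \<Lambda> \<or> v \<in> \<Lambda>"
    using assms(3) by (auto simp: edges_touching_def)
  have "{tail e, tip e} = {u, v}" using e uv(1) by simp
  then have *: "tail e = u \<and> tip e = v \<or> tail e = v \<and> tip e = u" by (auto simp: doubleton_eq_iff)
  then show "adj (tail e) (tip e)" using uv(2) assms(1) by (auto simp: simple_graph_def)
  then show "tail e \<noteq> tip e" using assms(1) by (auto simp: simple_graph_def)
  show "tail e \<in> \<Lambda> \<or> tip e \<in> \<Lambda>" using * uv(3) by auto
qed

text \<open>As \<open>u\<close> lies in \<open>\<Lambda>\<close>, every edge at \<open>u\<close>,
  also one leaving \<open>\<Lambda>\<close>, is in the edge set; so the diagonal counts the degree
  in the whole graph.\<close>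

lemma neg_laplacian_eq_sum_incidence:
  assumes "simple_graph V adj" "locally_finite_graph V adj" "finite \<Lambda>" "\<Lambda> \<subseteq> V"
    and "orientation (edges_touching adj \<Lambda>) tail tip" "u \<in> \<Lambda>" "v \<in> \<Lambda>"
  shows "- laplacian adj u v
    = (\<Sum>e\<in>edges_touching adj \<Lambda>. incidence tail tip e u * incidence tail tip e v)"
proof -
  let ?E = "edges_touching adj \<Lambda>"
  have fin: "finite ?E" using edges_touching_finite[OF assms(1-4)] .
  note or = orientation_adj[OF assms(1,5)]
  have star: "{e \<in> ?E. u \<in> e} = (\<lambda>w. {u, w}) ` {w. adj u w}"
    using assms(1,6) by (auto simp: edges_touching_def simple_graph_def)
  show ?thesis
  proof (cases "u = v")
    case True
    have "incidence tail tip e u * incidence tail tip e u = (if u \<in> e then 1 else 0)" if "e \<in> ?E" for e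
      using or(1,3)[OF that] by (auto simp: incidence_def)
    then have "(\<Sum>e\<in>?E. incidence tail tip e u * incidence tail tip e u) = real (card {e \<in> ?E. u \<in> e})"
      using fin by (simp add: sum.If_cases Int_def cong: sum.cong)
    also have "card {e \<in> ?E. u \<in> e} = card {w. adj u w}"
      unfolding star by (intro card_image) (auto simp: inj_on_def doubleton_eq_iff)
    finally show ?thesis using True by (simp add: laplacian_def)
  next
    case False
    have "incidence tail tip e u * incidence tail tip e v = (if e = {u, v} then - 1 else 0)" if "e \<in> ?E" for e
    proof (cases "e = {u, v}")
      case True
      with or(1)[OF that] have "{tail e, tip e} = {u, v}" by simp
      with True False show ?thesis by (auto simp: incidence_def doubleton_eq_iff)
    next
      case ne: False
      have "{tail e, tip e} = {u, v}" if "u \<in> {tail e, tip e}" "v \<in> {tail e, tip e}"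
        using that False by auto
      with or(1)[OF that] ne have "u \<notin> {tail e, tip e} \<or> v \<notin> {tail e, tip e}" by metis
      with ne show ?thesis by (auto simp: incidence_def)
    qed
    then have "(\<Sum>e\<in>?E. incidence tail tip e u * incidence tail tip e v)
        = (\<Sum>e\<in>?E. if e = {u, v} then - 1 else 0)" by (intro sum.cong) auto
    also have "\<dots> = (if {u, v} \<in> ?E then - 1 else 0)" using fin by simp
    also have "{u, v} \<in> ?E \<longleftrightarrow> adj u v"
      using assms(1,6) by (auto simp: edges_touching_def simple_graph_def doubleton_eq_iff)
    finally show ?thesis using False by (simp add: laplacian_def)
  qed
qed

section \<open>Connected edge sets and spanning trees\<close>

definition mg_reach :: "('e \<Rightarrow> 'w set) \<Rightarrow> 'e set \<Rightarrow> 'w \<Rightarrow> 'w \<Rightarrow> bool" where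
  "mg_reach ends T = (\<lambda>a b. \<exists>e\<in>T. ends e = {a, b})\<^sup>*\<^sup>*"

lemma mg_reach_refl [simp]: "mg_reach ends T x x"
  by (simp add: mg_reach_def)

lemma mg_reach_edge: "e \<in> T \<Longrightarrow> ends e = {x, y} \<Longrightarrow> mg_reach ends T x y"
  unfolding mg_reach_def by (rule r_into_rtranclp) blast

lemma mg_reach_trans: "mg_reach ends T x y \<Longrightarrow> mg_reach ends T y z \<Longrightarrow> mg_reach ends T x z"
  unfolding mg_reach_def by (rule rtranclp_trans)

lemma mg_reach_induct [consumes 1, case_names refl step]:
  assumes "mg_reach ends T x y" "P x"
    and "\<And>y z e. mg_reach ends T x y \<Longrightarrow> e \<in> T \<Longrightarrow> ends e = {y, z} \<Longrightarrow> P y \<Longrightarrow> P z"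
  shows "P y"
  using assms(1) unfolding mg_reach_def
proof (induction rule: rtranclp_induct)
  case (step y z)
  then show ?case using assms(3)[folded mg_reach_def, of y _ z] by (auto simp: mg_reach_def)
qed (rule assms(2))

lemma mg_reach_sym: "mg_reach ends T x y \<Longrightarrow> mg_reach ends T y x"
proof (induction rule: mg_reach_induct)
  case (step y z e)
  then show ?case using mg_reach_edge[of e T ends z y] mg_reach_trans by (metis insert_commute)
qed simp

lemma mg_reach_mono: "mg_reach ends S x y \<Longrightarrow> S \<subseteq> T \<Longrightarrow> mg_reach ends T x y"
  by (induction rule: mg_reach_induct) (auto intro: mg_reach_trans[OF _ mg_reach_edge])

lemma mg_connected_iff_root:
  assumes "r \<in> W"
  shows "mg_connected W ends T \<longleftrightarrow> (\<forall>x\<in>W. mg_reach ends T r x)"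
  unfolding mg_connected_def mg_reach_def[symmetric]
  using assms mg_reach_sym[of ends T] mg_reach_trans[of ends T] by blast

lemma mg_reach_crossing:
  assumes "mg_reach ends T x y" "x \<in> S" "y \<notin> S"
  obtains a b e where "a \<in> S" "b \<notin> S" "e \<in> T" "ends e = {a, b}"
  using assms by (induction rule: mg_reach_induct) blast+

text \<open>The reached set grows from \<open>r\<close> by one crossing edge at a time, as in Prim's
  algorithm. An upper bound on the number of edges is enough, since \<open>set_det_connected\<close>
  turns it into an equality.\<close>

lemma mg_connected_small_subset:
  assumes "finite U" "r \<notin> U" "mg_connected (insert r U) ends T" "\<And>e. e \<in> T \<Longrightarrow> ends e \<subseteq> insert r U"
  obtains T' where "T' \<subseteq> T" "card T' \<le> card U" "mg_connected (insert r U) ends T'"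
proof -
  let ?W = "insert r U"
  have "\<exists>S T'. r \<in> S \<and> S \<subseteq> ?W \<and> card S = Suc k \<and> T' \<subseteq> T \<and> finite T' \<and> card T' \<le> k \<and>
      (\<forall>x\<in>S. mg_reach ends T' r x)" if "k \<le> card U" for k
    using that
  proof (induction k)
    case 0
    then show ?case by (intro exI[of _ "{r}"] exI[of _ "{}"]) auto
  next
    case (Suc k)
    then obtain S T' where S: "r \<in> S" "S \<subseteq> ?W" "card S = Suc k" "T' \<subseteq> T" "finite T'" "card T' \<le> k"
      "\<And>x. x \<in> S \<Longrightarrow> mg_reach ends T' r x" by auto
    have "S \<noteq> ?W" using S(3) Suc.prems assms(1,2) by auto
    then obtain y where y: "y \<in> ?W" "y \<notin> S" using S(2) by blast
    have "mg_reach ends T r y" using assms(3) y(1) mg_connected_iff_root[of r ?W] by blast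
    then obtain a b e where ab: "a \<in> S" "b \<notin> S" "e \<in> T" "ends e = {a, b}"
      using S(1) y(2) by (rule mg_reach_crossing)
    have mono: "mg_reach ends (insert e T') r x" if "x \<in> S" for x
      using S(7)[OF that] by (rule mg_reach_mono) auto
    have "mg_reach ends (insert e T') r b"
      using mono[OF ab(1)] mg_reach_edge[of e _ ends a b] ab(4) by (auto intro: mg_reach_trans)
    moreover have "b \<in> ?W" using assms(4)[OF ab(3)] ab(4) by auto
    moreover have "finite S" using S(3) card.infinite by fastforce
    ultimately show ?case
      using S ab mono by (intro exI[of _ "insert b S"] exI[of _ "insert e T'"]) (auto simp: card_insert_if)
  qed
  from this[of "card U"] obtain S T' where S: "r \<in> S" "S \<subseteq> ?W" "card S = Suc (card U)" "T' \<subseteq> T"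
      "card T' \<le> card U" "\<And>x. x \<in> S \<Longrightarrow> mg_reach ends T' r x" by auto
  have "S = ?W" using S(2,3) assms(1,2) by (intro card_subset_eq) auto
  with S(6) have "mg_connected ?W ends T'" using mg_connected_iff_root[of r ?W ends T'] by blast
  with S(4,5) show thesis by (rule that)
qed

lemma mg_simple_path:
  assumes "mg_reach ends T x y"
  obtains ws es where "length ws = Suc (length es)" "distinct ws" "ws ! 0 = x" "ws ! length es = y"
    "\<And>i. i < length es \<Longrightarrow> es ! i \<in> T \<and> ends (es ! i) = {ws ! i, ws ! Suc i}"
proof -
  from assms have "\<exists>ws es. length ws = Suc (length es) \<and> distinct ws \<and> ws ! 0 = x \<and> ws ! length es = y \<and>
    (\<forall>i < length es. es ! i \<in> T \<and> ends (es ! i) = {ws ! i, ws ! Suc i})"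
  proof (induction rule: mg_reach_induct)
    case refl
    show ?case by (intro exI[of _ "[x]"] exI[of _ "[]"]) auto
  next
    case (step y z e)
    then obtain ws es where ws: "length ws = Suc (length es)" "distinct ws" "ws ! 0 = x" "ws ! length es = y"
      "\<And>i. i < length es \<Longrightarrow> es ! i \<in> T \<and> ends (es ! i) = {ws ! i, ws ! Suc i}" by blast
    show ?case
    proof (cases "z \<in> set ws")
      \<comment> \<open>Back at a visited vertex, the path is cut there.\<close>
      case True
      then obtain k where "k < length ws" "ws ! k = z" by (auto simp: in_set_conv_nth)
      with ws show ?thesis
        by (intro exI[of _ "take (Suc k) ws"] exI[of _ "take k es"]) auto
    next
      case False
      with ws step.hyps(2,3) show ?thesis
        by (intro exI[of _ "ws @ [z]"] exI[of _ "es @ [e]"]) (auto simp: nth_append less_Suc_eq)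
    qed
  qed
  then show thesis using that by blast
qed

text \<open>The edge \<open>e\<close> closes a simple path, whose edges are distinct because its
  vertices are. For \<open>a = b\<close> the path is empty and the cycle is the loop
  \<open>e\<close>.\<close>

lemma mg_cycle_of_reach:
  assumes "mg_reach ends T a b" "e \<notin> T" "ends e = {a, b}"
  obtains ws es where "mg_cycle ends (insert e T) ws es"
proof -
  obtain ws es where ws: "length ws = Suc (length es)" "distinct ws" "ws ! 0 = a" "ws ! length es = b"
    "\<And>i. i < length es \<Longrightarrow> es ! i \<in> T \<and> ends (es ! i) = {ws ! i, ws ! Suc i}"
    using mg_simple_path[OF assms(1)] by metis
  have "i = j" if "i < length es" "j < length es" "es ! i = es ! j" for i j
  proof -
    have "{ws ! i, ws ! Suc i} = {ws ! j, ws ! Suc j}" using ws(5) that by metis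
    then show ?thesis
      using that ws(1,2) by (auto simp: doubleton_eq_iff nth_eq_iff_index_eq)
  qed
  then have "distinct es" by (auto simp: distinct_conv_nth)
  moreover have "set es \<subseteq> T" using ws(5) by (auto simp: in_set_conv_nth)
  moreover have "ends ((es @ [e]) ! i) = {ws ! i, ws ! (Suc i mod length (es @ [e]))}"
    if "i < length (es @ [e])" for i
  proof (cases "i = length es")
    case True
    then show ?thesis using ws(3,4) assms(3) by (simp add: insert_commute)
  next
    case False
    then show ?thesis using that ws(5)[of i] by (simp add: nth_append)
  qed
  ultimately have "mg_cycle ends (insert e T) ws (es @ [e])"
    using ws(1,2) assms(2) by (auto simp: mg_cycle_def)
  then show thesis using that by blast
qed

text \<open>The rest of the cycle bypasses the removed edge. Removing the last one leaves a path
  whose indices do not wrap around.\<close>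

lemma mg_connected_remove_cycle_edge:
  assumes "mg_connected W ends T" "mg_cycle ends T ws es"
  shows "mg_connected W ends (T - {last es})"
proof -
  let ?R = "mg_reach ends (T - {last es})"
  obtain n where n: "length es = Suc n" "length ws = Suc n"
    using assms(2) by (cases es) (auto simp: mg_cycle_def)
  have es: "distinct es" "set es \<subseteq> T" "\<And>i. i < Suc n \<Longrightarrow> ends (es ! i) = {ws ! i, ws ! (Suc i mod Suc n)}"
    using assms(2) n by (auto simp: mg_cycle_def)
  have last: "last es = es ! n" using n(1) by (metis diff_Suc_1 last_conv_nth list.size(3) nat.distinct(1))
  have path: "?R (ws ! 0) (ws ! i)" if "i \<le> n" for i
    using that
  proof (induction i)
    case (Suc i)
    have "es ! i \<in> T" using es(2) n(1) Suc.prems nth_mem[of i es] by auto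
    moreover have "es ! i \<noteq> last es" using es(1) n(1) Suc.prems last by (simp add: nth_eq_iff_index_eq)
    moreover have "ends (es ! i) = {ws ! i, ws ! Suc i}" using es(3)[of i] Suc.prems by simp
    ultimately have "?R (ws ! i) (ws ! Suc i)" by (intro mg_reach_edge[of "es ! i"]) auto
    with Suc show ?case by (auto intro: mg_reach_trans)
  qed simp
  have bypass: "?R a b" if e: "e \<in> T" "ends e = {a, b}" for a b e
  proof (cases "e = last es")
    case True
    then have "{a, b} = {ws ! n, ws ! 0}" using e(2) es(3)[of n] last by simp
    then show ?thesis using path[of n] mg_reach_sym[OF path[of n]] by (auto simp: doubleton_eq_iff)
  next
    case False
    with e show ?thesis by (intro mg_reach_edge) auto
  qed
  have "?R x y" if "mg_reach ends T x y" for x y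
    using that by (induction rule: mg_reach_induct) (auto intro: mg_reach_trans bypass)
  then show ?thesis using assms(1) unfolding mg_connected_def mg_reach_def[symmetric] by blast
qed

section \<open>The matrix-tree theorem\<close>

text \<open>The discrete gradient of \<open>y\<close>, grounded at the wired vertex:
  \<open>None\<close> has no coordinate and gets the value 0.\<close>

lemma sum_incidence_mult:
  fixes y :: "'v \<Rightarrow> real"
  assumes "finite \<Lambda>" "s e \<in> insert None (Some ` \<Lambda>)" "t e \<in> insert None (Some ` \<Lambda>)"
  shows "(\<Sum>u\<in>\<Lambda>. incidence s t e (Some u) * y u) = case_option 0 y (t e) - case_option 0 y (s e)"
proof -
  have "(\<Sum>u\<in>\<Lambda>. (if Some u = w then 1 else 0) * y u) = case_option 0 y w"
    if "w \<in> insert None (Some ` \<Lambda>)" for w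
    using that assms(1) by (auto simp: if_distrib[of "\<lambda>c. c * _"] cong: if_cong)
  then show ?thesis
    using assms by (simp add: incidence_def left_diff_distrib sum_subtractf)
qed

lemma set_det_eq_0_of_kernel:
  assumes "finite \<Lambda>" "u\<^sub>0 \<in> \<Lambda>" "y u\<^sub>0 \<noteq> 0" "\<And>u. u \<in> \<Lambda> \<Longrightarrow> (\<Sum>v\<in>\<Lambda>. A u v * y v) = 0"
  shows "set_det \<Lambda> A = 0"
proof -
  obtain us where us: "set us = \<Lambda>" "distinct us"
    using finite_distinct_list[OF assms(1)] by blast
  let ?n = "length us"
  let ?A = "Matrix.mat ?n ?n (\<lambda>(i, j). A (us ! i) (us ! j))" and ?y = "Matrix.vec ?n (\<lambda>i. y (us ! i))"
  obtain k where k: "k < ?n" "us ! k = u\<^sub>0" using assms(2) us(1) by (auto simp: in_set_conv_nth)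
  have "?y \<noteq> 0\<^sub>v ?n"
  proof
    assume "?y = 0\<^sub>v ?n"
    then have "?y $ k = 0\<^sub>v ?n $ k" by (simp only:)
    then show False using k assms(3) by simp
  qed
  moreover have "?A *\<^sub>v ?y = 0\<^sub>v ?n"
  proof (rule eq_vecI)
    fix i assume "i < dim_vec (0\<^sub>v ?n :: real Matrix.vec)"
    then have i: "i < ?n" by simp
    have "(?A *\<^sub>v ?y) $ i = (\<Sum>j = 0..<?n. A (us ! i) (us ! j) * y (us ! j))"
      using i by (simp add: scalar_prod_def)
    also have "\<dots> = (\<Sum>v\<in>\<Lambda>. A (us ! i) v * y v)"
      using sum.reindex_bij_betw[OF bij_betw_nth[OF us(2) refl us(1)[symmetric]], of "\<lambda>v. A (us ! i) v * y v"]
      by (simp add: lessThan_atLeast0)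
    also have "\<dots> = 0" using i us(1) by (intro assms(4)) auto
    finally show "(?A *\<^sub>v ?y) $ i = 0\<^sub>v ?n $ i" using i by simp
  qed simp
  ultimately have "Determinant.det ?A = 0"
    by (subst det_0_iff_vec_prod_zero[of _ ?n]) (auto intro!: exI[of _ ?y])
  then show ?thesis using set_det_eq_det[OF us(2), of A] us(1) by simp
qed

text \<open>The indicator function of the vertices not connected to the root lies in the kernel.\<close>

lemma set_det_disconnected:
  fixes s t :: "'e \<Rightarrow> 'v option"
  assumes "finite \<Lambda>" "finite T"
    and ends: "\<And>e. e \<in> T \<Longrightarrow> ends e = {s e, t e}"
      "\<And>e. e \<in> T \<Longrightarrow> s e \<in> insert None (Some ` \<Lambda>)" "\<And>e. e \<in> T \<Longrightarrow> t e \<in> insert None (Some ` \<Lambda>)"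
    and "\<not> mg_connected (insert None (Some ` \<Lambda>)) ends T"
  shows "set_det \<Lambda> (\<lambda>u v. \<Sum>e\<in>T. incidence s t e (Some u) * incidence s t e (Some v)) = 0"
proof -
  define y :: "'v \<Rightarrow> real" where "y u = (if mg_reach ends T None (Some u) then 0 else 1)" for u
  obtain u\<^sub>0 where u0: "u\<^sub>0 \<in> \<Lambda>" "y u\<^sub>0 \<noteq> 0"
    using assms(6) by (auto simp: mg_connected_iff_root[of None] y_def)
  \<comment> \<open>The default value 0 at \<open>None\<close> fits, since the root reaches
    itself.\<close>
  have y: "case_option 0 y x = (if mg_reach ends T None x then 0 else 1)" for x
    by (auto simp: y_def split: option.split)
  have "(\<Sum>v\<in>\<Lambda>. incidence s t e (Some v) * y v) = 0" if "e \<in> T" for e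
  proof -
    have "mg_reach ends T (s e) (t e)" using that ends(1)[OF that] by (rule mg_reach_edge)
    then have "mg_reach ends T None (s e) \<longleftrightarrow> mg_reach ends T None (t e)"
      by (meson mg_reach_sym mg_reach_trans)
    then show ?thesis
      unfolding sum_incidence_mult[of \<Lambda> s e t y, OF assms(1) ends(2,3)[OF that]] y by simp
  qed
  then have "(\<Sum>v\<in>\<Lambda>. (\<Sum>e\<in>T. incidence s t e (Some u) * incidence s t e (Some v)) * y v) = 0" for u
    unfolding sum_distrib_right by (subst sum.swap) (simp add: mult.assoc flip: sum_distrib_left)
  then show ?thesis by (rule set_det_eq_0_of_kernel[of \<Lambda> u\<^sub>0 y, OF assms(1) u0])
qed

text \<open>Signed incidence vectors along a path from the root telescope to the unit vector of its
  end; the start leaves no trace because \<open>None\<close> has no coordinate.\<close>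

lemma mg_reach_integer_combination:
  fixes s t :: "'e \<Rightarrow> 'v option"
  assumes "finite T" "\<And>e. e \<in> T \<Longrightarrow> ends e = {s e, t e}" "mg_reach ends T None x"
  shows "\<exists>c :: 'e \<Rightarrow> int. \<forall>v. (\<Sum>e\<in>T. of_int (c e) * incidence s t e (Some v)) = (if x = Some v then 1 else 0)"
  using assms(3)
proof (induction rule: mg_reach_induct)
  case refl
  show ?case by (intro exI[of _ "\<lambda>_. 0"]) simp
next
  case (step y z e)
  then obtain c :: "'e \<Rightarrow> int" where
    c: "\<And>v. (\<Sum>e\<in>T. of_int (c e) * incidence s t e (Some v)) = (if y = Some v then 1 else 0)"
    by blast
  note e = step.hyps(2,3)
  have "{s e, t e} = {y, z}" using assms(2)[OF e(1)] e(2) by simp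
  then have "s e = y \<and> t e = z \<or> s e = z \<and> t e = y" by (auto simp: doubleton_eq_iff)
  \<comment> \<open>The sign records the direction in which \<open>e\<close> is traversed. It is
    added to the old coefficient, since the walk may have used \<open>e\<close> before.\<close>
  then obtain \<epsilon> :: int where \<epsilon>: "\<And>v. (if y = Some v then 1 else 0) + of_int \<epsilon> * incidence s t e (Some v)
      = (if z = Some v then 1 else 0)"
  proof
    assume "s e = y \<and> t e = z"
    then show thesis by (intro that[of 1]) (auto simp: incidence_def)
  next
    assume "s e = z \<and> t e = y"
    then show thesis by (intro that[of "- 1"]) (auto simp: incidence_def)
  qed
  let ?d = "\<lambda>f. c f + (if f = e then \<epsilon> else 0)"
  have "(\<Sum>f\<in>T. of_int (?d f) * incidence s t f (Some v)) = (if z = Some v then 1 else 0)" for v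
  proof -
    have "(\<Sum>f\<in>T. of_int (?d f) * incidence s t f (Some v))
        = (\<Sum>f\<in>T. of_int (c f) * incidence s t f (Some v) + (if f = e then of_int \<epsilon> * incidence s t f (Some v) else 0))"
      by (intro sum.cong) (auto simp: distrib_right)
    also have "\<dots> = (if z = Some v then 1 else 0)"
      using assms(1) e(1) c[of v] \<epsilon>[of v] by (simp add: sum.distrib)
    finally show ?thesis .
  qed
  then show ?case by (intro exI[of _ ?d]) blast
qed

lemma det_in_Ints:
  fixes A :: "real mat"
  assumes "A \<in> carrier_mat n n" "\<And>i j. i < n \<Longrightarrow> j < n \<Longrightarrow> A $$ (i, j) \<in> \<int>"
  shows "Determinant.det A \<in> \<int>"
  using assms unfolding Determinant.det_def
  by (auto intro!: Ints_sum Ints_mult Ints_prod simp: permutes_in_image)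

text \<open>
  Connectedness makes every unit vector an integer combination of incidence vectors. So the incidence
  matrix, padded with zero rows to a square one, has an integer left inverse, and its determinant is
  \<open>1\<close> or \<open>-1\<close>; a zero row is therefore impossible.
\<close>

lemma set_det_connected:
  fixes s t :: "'e \<Rightarrow> 'v option"
  assumes "finite \<Lambda>" "finite T"
    and ends: "\<And>e. e \<in> T \<Longrightarrow> ends e = {s e, t e}"
    and "mg_connected (insert None (Some ` \<Lambda>)) ends T" "card T \<le> card \<Lambda>"
  shows "card T = card \<Lambda>"
    and "set_det \<Lambda> (\<lambda>u v. \<Sum>e\<in>T. incidence s t e (Some u) * incidence s t e (Some v)) = 1"
proof -
  let ?b = "\<lambda>e u. incidence s t e (Some u)"
  have "\<exists>c :: 'e \<Rightarrow> int. \<forall>v. (\<Sum>e\<in>T. of_int (c e) * ?b e v) = (if u = v then 1 else 0)" if "u \<in> \<Lambda>" for u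
  proof -
    have "mg_reach ends T None (Some u)" 
      using that assms(4) mg_connected_iff_root[of None "insert None (Some ` \<Lambda>)" ends T] by blast
    from mg_reach_integer_combination[of T ends s t, OF assms(2) ends this] show ?thesis by simp
  qed
  then obtain c :: "'v \<Rightarrow> 'e \<Rightarrow> int" where
    c: "\<And>u v. u \<in> \<Lambda> \<Longrightarrow> (\<Sum>e\<in>T. of_int (c u e) * ?b e v) = (if u = v then 1 else 0)" by metis
  obtain us where us: "set us = \<Lambda>" "distinct us"
    using finite_distinct_list[OF assms(1)] by blast
  obtain ts where ts: "set ts = T" "distinct ts"
    using finite_distinct_list[OF assms(2)] by blast
  let ?n = "length us" and ?m = "length ts"
  have card: "card \<Lambda> = ?n" "card T = ?m" using us ts distinct_card by metis+
  with assms(5) have mn: "?m \<le> ?n" by simp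
  have sum_ts: "(\<Sum>j = 0..<?n. if j < ?m then f (ts ! j) else 0) = sum f T" for f :: "'e \<Rightarrow> real"
  proof -
    have "(\<Sum>j = 0..<?n. if j < ?m then f (ts ! j) else 0) = (\<Sum>j<?m. f (ts ! j))"
      using mn by (intro sum.mono_neutral_cong_right) auto
    also have "\<dots> = sum f T"
      using sum.reindex_bij_betw[OF bij_betw_nth[OF ts(2) refl ts(1)[symmetric]]] by simp
    finally show ?thesis .
  qed
  define C where "C = Matrix.mat ?n ?n (\<lambda>(i, j). if j < ?m then real_of_int (c (us ! i) (ts ! j)) else 0)"
  define B where "B = Matrix.mat ?n ?n (\<lambda>(j, k). if j < ?m then ?b (ts ! j) (us ! k) else 0)"
  have carrier: "C \<in> carrier_mat ?n ?n" "B \<in> carrier_mat ?n ?n" "B\<^sup>T \<in> carrier_mat ?n ?n"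
    by (simp_all add: C_def B_def)
  have "C * B = 1\<^sub>m ?n"
  proof (rule eq_matI)
    fix i k assume "i < dim_row (1\<^sub>m ?n :: real mat)" "k < dim_col (1\<^sub>m ?n :: real mat)"
    then have ik: "i < ?n" "k < ?n" by simp_all
    then have "(C * B) $$ (i, k)
        = (\<Sum>j = 0..<?n. if j < ?m then of_int (c (us ! i) (ts ! j)) * ?b (ts ! j) (us ! k) else 0)"
      by (auto simp: C_def B_def scalar_prod_def intro: sum.cong)
    also have "\<dots> = (\<Sum>e\<in>T. of_int (c (us ! i) e) * ?b e (us ! k))" by (rule sum_ts)
    also have "\<dots> = (if us ! i = us ! k then 1 else 0)" using ik us(1) by (intro c) auto
    also have "\<dots> = 1\<^sub>m ?n $$ (i, k)" using ik us(2) by (simp add: nth_eq_iff_index_eq)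
    finally show "(C * B) $$ (i, k) = 1\<^sub>m ?n $$ (i, k)" .
  qed (simp_all add: C_def B_def)
  then have det: "Determinant.det C * Determinant.det B = 1"
    using det_mult[OF carrier(1,2)] by simp
  have "?m = ?n"
  proof (rule ccontr)
    assume "?m \<noteq> ?n"
    with mn have "?m < ?n" by simp
    have zero: "(\<Prod>i = 0..<?n. B $$ (i, p i)) = 0" if "p permutes {0..<?n}" for p
      using \<open>?m < ?n\<close> permutes_in_image[OF that, of ?m]
      by (intro prod_zero bexI[of _ ?m]) (auto simp: B_def)
    have "Determinant.det B = (\<Sum>p | p permutes {0..<?n}. of_int (sign p) * (\<Prod>i = 0..<?n. B $$ (i, p i)))"
      using carrier(2) by (simp add: Determinant.det_def)
    also have "\<dots> = 0" by (intro sum.neutral) (simp add: zero del: prod_zero_iff)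
    finally have "Determinant.det B = 0" .
    with det show False by simp
  qed
  with card show "card T = card \<Lambda>" by simp
  have "Determinant.det C \<in> \<int>" "Determinant.det B \<in> \<int>"
    using carrier by (auto intro!: det_in_Ints simp: C_def B_def incidence_def)
  then obtain k l where kl: "Determinant.det C = real_of_int k" "Determinant.det B = real_of_int l"
    by (elim Ints_cases)
  with det have "real_of_int (k * l) = 1" by simp
  then have "k * l = 1" by (metis of_int_eq_1_iff)
  then have "l * l = 1" by (metis mult.commute zmult_eq_1_iff mult_minus_left mult_minus_right mult_1 minus_minus)
  then have sq: "Determinant.det B * Determinant.det B = 1" using kl(2) by (metis of_int_1 of_int_mult)
  \<comment> \<open>The rows of \<open>B\<close> are edges, so this product sums over edges; its
    determinant is the square of that of \<open>B\<close>, which removes the undetermined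
    sign.\<close>
  have "B\<^sup>T * B = Matrix.mat ?n ?n (\<lambda>(i, k). \<Sum>e\<in>T. ?b e (us ! i) * ?b e (us ! k))"
  proof (rule eq_matI)
    fix i k assume "i < dim_row (Matrix.mat ?n ?n (\<lambda>(i, k). \<Sum>e\<in>T. ?b e (us ! i) * ?b e (us ! k)))"
      "k < dim_col (Matrix.mat ?n ?n (\<lambda>(i, k). \<Sum>e\<in>T. ?b e (us ! i) * ?b e (us ! k)))"
    then have ik: "i < ?n" "k < ?n" by simp_all
    then have "(B\<^sup>T * B) $$ (i, k) = (\<Sum>j = 0..<?n. if j < ?m then ?b (ts ! j) (us ! i) * ?b (ts ! j) (us ! k) else 0)"
      by (auto simp: B_def scalar_prod_def intro: sum.cong)
    also have "\<dots> = (\<Sum>e\<in>T. ?b e (us ! i) * ?b e (us ! k))" by (rule sum_ts)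
    finally show "(B\<^sup>T * B) $$ (i, k) = Matrix.mat ?n ?n (\<lambda>(i, k). \<Sum>e\<in>T. ?b e (us ! i) * ?b e (us ! k)) $$ (i, k)"
      using ik by simp
  qed (simp_all add: B_def)
  then have "set_det \<Lambda> (\<lambda>u v. \<Sum>e\<in>T. ?b e u * ?b e v) = Determinant.det (B\<^sup>T * B)"
    using set_det_eq_det[OF us(2), of "\<lambda>u v. \<Sum>e\<in>T. ?b e u * ?b e v"] us(1) by simp
  also have "\<dots> = 1" using sq det_mult[OF carrier(3,2)] det_transpose[OF carrier(2)] by simp
  finally show "set_det \<Lambda> (\<lambda>u v. \<Sum>e\<in>T. ?b e u * ?b e v) = 1" .
qed

text \<open>By the determinant argument no connected edge set has fewer than
  \<open>card \<Lambda>\<close> edges. An acyclic connected set equals its small connected subset,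
  as a further edge would close a cycle; conversely, deleting an edge of a cycle would leave a
  connected set that is too small.\<close>

lemma spanning_tree_iff:
  fixes s t :: "'e \<Rightarrow> 'v option"
  assumes "finite \<Lambda>" "finite E"
    and ends: "\<And>e. e \<in> E \<Longrightarrow> ends e = {s e, t e}"
      "\<And>e. e \<in> E \<Longrightarrow> s e \<in> insert None (Some ` \<Lambda>)" "\<And>e. e \<in> E \<Longrightarrow> t e \<in> insert None (Some ` \<Lambda>)"
  shows "spanning_tree (insert None (Some ` \<Lambda>)) E ends T \<longleftrightarrow>
    T \<subseteq> E \<and> card T = card \<Lambda> \<and> mg_connected (insert None (Some ` \<Lambda>)) ends T"
proof -
  let ?W = "insert None (Some ` \<Lambda>)"
  have card: "card (Some ` \<Lambda>) = card \<Lambda>" by (simp add: card_image)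
  have small: "card S = card \<Lambda>" if "S \<subseteq> E" "mg_connected ?W ends S" "card S \<le> card \<Lambda>" for S
    using that finite_subset[OF that(1) assms(2)] ends(1)
    by (intro set_det_connected(1)[OF assms(1), of S ends s t]) auto
  have "card T = card \<Lambda>" if T: "T \<subseteq> E" "mg_connected ?W ends T" "\<not> (\<exists>ws es. mg_cycle ends T ws es)"
  proof -
    obtain T' where T': "T' \<subseteq> T" "card T' \<le> card (Some ` \<Lambda>)" "mg_connected ?W ends T'"
    proof (rule mg_connected_small_subset[of "Some ` \<Lambda>" None ends T])
      show "ends e \<subseteq> ?W" if "e \<in> T" for e
      proof -
        have "e \<in> E" using that T(1) by blast
        from ends(2,3)[OF this] show ?thesis 
          unfolding ends(1)[OF \<open>e \<in> E\<close>] by (simp only: insert_subset empty_subsetI simp_thms)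
      qed
    qed (use assms(1) T(2) in auto)
    have "T' = T"
    proof (rule ccontr)
      assume "T' \<noteq> T"
      then obtain e where e: "e \<in> T" "e \<notin> T'" using T'(1) by blast
      then have E: "ends e = {s e, t e}" "s e \<in> ?W" "t e \<in> ?W" using T(1) ends[of e] by auto
      then have "mg_reach ends T' (s e) (t e)" 
        using T'(3) E(2,3) unfolding mg_connected_def mg_reach_def[symmetric] by blast
      then obtain ws es where "mg_cycle ends (insert e T') ws es"
        using e(2) E(1) by (rule mg_cycle_of_reach)
      then have "mg_cycle ends T ws es" using e(1) T'(1) by (auto simp: mg_cycle_def)
      with T(3) show False by blast
    qed
    with T' T small card show ?thesis by auto
  qed
  moreover have False if T: "T \<subseteq> E" "mg_connected ?W ends T" "card T = card \<Lambda>" "mg_cycle ends T ws es" for ws es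
  proof -
    have "last es \<in> T" using T(4) last_in_set[of es] by (auto simp: mg_cycle_def)
    moreover have "finite T" using T(1) assms(2) by (rule finite_subset)
    ultimately have "card (T - {last es}) < card \<Lambda>" using T(3) by (metis card_Diff1_less)
    then show False
      using small[of "T - {last es}"] mg_connected_remove_cycle_edge[OF T(2,4)] T(1) by auto
  qed
  ultimately show ?thesis unfolding spanning_tree_def by blast
qed

text \<open>Among the sets of \<open>card \<Lambda>\<close> edges that index the Cauchy--Binet sum,
  the connected ones are the trees and have determinant 1; the others have determinant 0.\<close>

theorem weighted_matrix_tree:
  fixes s t :: "'e \<Rightarrow> 'v option" and w :: "'e \<Rightarrow> real"
  assumes "finite \<Lambda>" "finite E"
    and ends: "\<And>e. e \<in> E \<Longrightarrow> ends e = {s e, t e}"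
      "\<And>e. e \<in> E \<Longrightarrow> s e \<in> insert None (Some ` \<Lambda>)" "\<And>e. e \<in> E \<Longrightarrow> t e \<in> insert None (Some ` \<Lambda>)"
  shows "set_det \<Lambda> (\<lambda>u v. \<Sum>e\<in>E. w e * incidence s t e (Some u) * incidence s t e (Some v))
    = (\<Sum>T | spanning_tree (insert None (Some ` \<Lambda>)) E ends T. \<Prod>e\<in>T. w e)"
proof -
  let ?W = "insert None (Some ` \<Lambda>)"
  let ?D = "\<lambda>T. set_det \<Lambda> (\<lambda>u v. \<Sum>e\<in>T. incidence s t e (Some u) * incidence s t e (Some v))"
  have D: "?D T = (if spanning_tree ?W E ends T then 1 else 0)" if "T \<subseteq> E" "card T = card \<Lambda>" for T
  proof -
    note fin = finite_subset[OF that(1) assms(2)]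
    have E: "ends e = {s e, t e}" "s e \<in> ?W" "t e \<in> ?W" if "e \<in> T" for e
      using \<open>T \<subseteq> E\<close> that ends[of e] by auto
    have "spanning_tree ?W E ends T \<longleftrightarrow> mg_connected ?W ends T"
      using spanning_tree_iff[of \<Lambda> E ends s t T, OF assms] that by blast
    then show ?thesis
      using set_det_connected(2)[of \<Lambda> T ends s t, OF assms(1) fin E(1)]
        set_det_disconnected[of \<Lambda> T ends s t, OF assms(1) fin E] that(2)
      by (cases "mg_connected ?W ends T") (simp_all only: if_True if_False order.refl simp_thms)
  qed
  have "set_det \<Lambda> (\<lambda>u v. \<Sum>e\<in>E. w e * incidence s t e (Some u) * incidence s t e (Some v))
      = (\<Sum>T | T \<subseteq> E \<and> card T = card \<Lambda>. (\<Prod>e\<in>T. w e) * ?D T)"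
    by (rule set_det_Cauchy_Binet[OF assms(1,2)])
  also have "\<dots> = (\<Sum>T | spanning_tree ?W E ends T. \<Prod>e\<in>T. w e)"
    using assms(2) by (intro sum.mono_neutral_cong_right) (auto simp: D spanning_tree_iff[OF assms])
  finally show ?thesis .
qed

section \<open>The transfer-current determinant\<close>

text \<open>Sylvester's identity: \<open>?P\<close> is unitriangular and
  \<open>?P * ?Q = ?R * ?P\<close>, where the block triangular matrices \<open>?Q\<close> and
  \<open>?R\<close> have the two sides as determinants.\<close>

lemma det_one_plus_mult_commute:
  fixes U V :: "'a :: idom mat"
  assumes U: "U \<in> carrier_mat n m" and V: "V \<in> carrier_mat m n"
  shows "Determinant.det (1\<^sub>m n + U * V) = Determinant.det (1\<^sub>m m + V * U)"
proof -
  let ?P = "four_block_mat (1\<^sub>m n) (0\<^sub>m n m) (- V) (1\<^sub>m m)"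
  let ?Q = "four_block_mat (1\<^sub>m n) U (0\<^sub>m m n) (1\<^sub>m m + V * U)"
  let ?R = "four_block_mat (1\<^sub>m n + U * V) U (0\<^sub>m m n) (1\<^sub>m m)"
  have UV: "U * V \<in> carrier_mat n n" "V * U \<in> carrier_mat m m" using assms by auto
  have one_UV: "1\<^sub>m n + U * V \<in> carrier_mat n n" and one_VU: "1\<^sub>m m + V * U \<in> carrier_mat m m"
    using UV by auto
  have neg: "- V * U = - (V * U)" "U * - V = - (U * V)"
    using assms by (auto simp: uminus_mult_left_mat uminus_mult_right_mat)
  have "?P * ?Q = four_block_mat (1\<^sub>m n * 1\<^sub>m n + 0\<^sub>m n m * 0\<^sub>m m n)
      (1\<^sub>m n * U + 0\<^sub>m n m * (1\<^sub>m m + V * U)) (- V * 1\<^sub>m n + 1\<^sub>m m * 0\<^sub>m m n)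
      (- V * U + 1\<^sub>m m * (1\<^sub>m m + V * U))"
    using assms by (intro mult_four_block_mat[of _ n n _ m _ m]) auto
  \<comment> \<open>Both products are the block matrix with rows \<open>1, U\<close> and
    \<open>- V, 1\<close>. Each block is rewritten into the unsimplified block of
    \<open>?R * ?P\<close>, so that the multiplication rule can be read backwards.\<close>
  also have "1\<^sub>m n * 1\<^sub>m n + 0\<^sub>m n m * 0\<^sub>m m n = (1\<^sub>m n + U * V) * 1\<^sub>m n + U * - V"
    using assms UV unfolding neg right_mult_one_mat[OF one_UV] by (intro eq_matI) auto
  also have "1\<^sub>m n * U + 0\<^sub>m n m * (1\<^sub>m m + V * U) = (1\<^sub>m n + U * V) * 0\<^sub>m n m + U * 1\<^sub>m m"
    using assms UV by simp
  also have "- V * 1\<^sub>m n + 1\<^sub>m m * 0\<^sub>m m n = 0\<^sub>m m n * 1\<^sub>m n + 1\<^sub>m m * - V"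
    using assms by simp
  also have "- V * U + 1\<^sub>m m * (1\<^sub>m m + V * U) = 0\<^sub>m m n * 0\<^sub>m n m + 1\<^sub>m m * 1\<^sub>m m"
    using assms UV unfolding neg left_mult_one_mat[OF one_VU] by (intro eq_matI) auto
  also have "four_block_mat ((1\<^sub>m n + U * V) * 1\<^sub>m n + U * - V) ((1\<^sub>m n + U * V) * 0\<^sub>m n m + U * 1\<^sub>m m)
      (0\<^sub>m m n * 1\<^sub>m n + 1\<^sub>m m * - V) (0\<^sub>m m n * 0\<^sub>m n m + 1\<^sub>m m * 1\<^sub>m m) = ?R * ?P"
    using assms by (intro mult_four_block_mat[symmetric, of _ n n _ m _ m]) auto
  finally have "?P * ?Q = ?R * ?P" .
  moreover have carrier: "?P \<in> carrier_mat (n + m) (n + m)" "?Q \<in> carrier_mat (n + m) (n + m)" "?R \<in> carrier_mat (n + m) (n + m)"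
    using assms by auto
  ultimately have "Determinant.det ?P * Determinant.det ?Q = Determinant.det ?R * Determinant.det ?P"
    by (metis det_mult)
  moreover have "Determinant.det ?P = 1"
    using assms by (subst det_four_block_mat_upper_right_zero[of _ n _ m]) auto
  moreover have "Determinant.det ?Q = Determinant.det (1\<^sub>m m + V * U)"
    using assms by (subst det_four_block_mat_lower_left_zero[of _ n _ m]) auto
  moreover have "Determinant.det ?R = Determinant.det (1\<^sub>m n + U * V)"
    using assms by (subst det_four_block_mat_lower_left_zero[of _ n _ m]) auto
  ultimately show ?thesis by simp
qed

lemma sum_nth_eq_sum_set:
  "distinct us \<Longrightarrow> (\<Sum>k = 0..<length us. f (us ! k)) = sum f (set us)"
  using sum.reindex_bij_betw[OF bij_betw_nth[OF _ refl refl], of us f] by (simp add: lessThan_atLeast0)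

section \<open>Green's function and transfer currents\<close>

lemma is_green_green:
  assumes "finite \<Lambda>" "set_det \<Lambda> (\<lambda>u v. - laplacian adj u v) \<noteq> 0"
  shows "is_green adj \<Lambda> (green adj \<Lambda>)"
proof -
  obtain us where us: "set us = \<Lambda>" "distinct us"
    using finite_distinct_list[OF assms(1)] by blast
  let ?n = "length us"
  let ?A = "Matrix.mat ?n ?n (\<lambda>(i, j). - laplacian adj (us ! i) (us ! j))"
  have "Determinant.det ?A \<noteq> 0"
    using assms(2) set_det_eq_det[OF us(2), of "\<lambda>u v. - laplacian adj u v"] us(1) by simp
  then have "?A \<in> Units (ring_mat TYPE(real) ?n ())" by (intro det_non_zero_imp_unit) simp_all
  then obtain B where B: "B \<in> carrier_mat ?n ?n" "B * ?A = 1\<^sub>m ?n" "?A * B = 1\<^sub>m ?n"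
    unfolding Units_def by (auto simp: ring_mat_simps)
  \<comment> \<open>The definite description \<open>green\<close> needs an existing candidate: the
    inverse matrix, read back from positions to vertices through \<open>idx\<close>.\<close>
  define idx where "idx = the_inv_into {..<?n} ((!) us)"
  have inj: "inj_on ((!) us) {..<?n}" using us(2) by (simp add: inj_on_nth)
  have idx: "idx (us ! k) = k" if "k < ?n" for k
    using that by (simp add: idx_def the_inv_into_f_f[OF inj])
  define g where "g u v = (if u \<in> \<Lambda> \<and> v \<in> \<Lambda> then B $$ (idx u, idx v) else 0)" for u v
  have g: "g (us ! i) (us ! j) = B $$ (i, j)" if "i < ?n" "j < ?n" for i j
    using that us(1) by (auto simp: g_def idx)
  have "is_green adj \<Lambda> g"
    unfolding is_green_def
  proof (intro conjI ballI allI impI)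
    fix u v assume uv: "u \<in> \<Lambda>" "v \<in> \<Lambda>"
    then obtain i j where ij: "i < ?n" "j < ?n" "u = us ! i" "v = us ! j"
      using us(1) by (metis in_set_conv_nth)
    have "(?A * B) $$ (i, j) = (\<Sum>k = 0..<?n. - laplacian adj u (us ! k) * g (us ! k) v)"
      using ij B(1) by (simp add: scalar_prod_def g)
    also have "\<dots> = (\<Sum>w\<in>\<Lambda>. - laplacian adj u w * g w v)"
      by (subst sum_nth_eq_sum_set[OF us(2)]) (simp add: us(1))
    finally show "(\<Sum>w\<in>\<Lambda>. - laplacian adj u w * g w v) = (if u = v then 1 else 0)"
      using ij us(2) by (simp add: B(3) nth_eq_iff_index_eq)
    have "(B * ?A) $$ (i, j) = (\<Sum>k = 0..<?n. g u (us ! k) * - laplacian adj (us ! k) v)"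
      using ij B(1) by (simp add: scalar_prod_def g)
    also have "\<dots> = (\<Sum>w\<in>\<Lambda>. g u w * - laplacian adj w v)"
      by (subst sum_nth_eq_sum_set[OF us(2)]) (simp add: us(1))
    finally show "(\<Sum>w\<in>\<Lambda>. g u w * - laplacian adj w v) = (if u = v then 1 else 0)"
      using ij us(2) by (simp add: B(2) nth_eq_iff_index_eq)
  qed (auto simp: g_def)
  then show ?thesis
    unfolding green_def
    by (rule theI[where P = "is_green adj \<Lambda>"]) (rule is_green_unique[OF assms(1) _ \<open>is_green adj \<Lambda> g\<close>])
qed

text \<open>The transfer current is the Green form evaluated on two incidence vectors. Endpoints
  outside \<open>\<Lambda>\<close> contribute nothing on either side, as Green's function vanishes
  there.\<close>

lemma transfer_current_eq_sum:
  assumes "finite \<Lambda>" "is_green adj \<Lambda> (green adj \<Lambda>)"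
  shows "transfer_current adj \<Lambda> tail tip f g = (\<Sum>u\<in>\<Lambda>. \<Sum>v\<in>\<Lambda>.
    incidence tail tip f u * green adj \<Lambda> u v * incidence tail tip g v)"
proof -
  have *: "(\<Sum>u\<in>\<Lambda>. incidence tail tip e u * h u) = h (tip e) - h (tail e)"
    if "\<And>u. u \<notin> \<Lambda> \<Longrightarrow> h u = 0" for h :: "'a \<Rightarrow> real" and e
  proof -
    have "(\<Sum>u\<in>\<Lambda>. (if u = w then 1 else 0) * h u) = h w" for w
      using that assms(1) by (simp add: if_distrib[of "\<lambda>c. c * _"] cong: if_cong)
    then show ?thesis by (simp add: incidence_def left_diff_distrib sum_subtractf)
  qed
  have zero: "green adj \<Lambda> u v = 0" if "u \<notin> \<Lambda> \<or> v \<notin> \<Lambda>" for u v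
    using assms(2) that by (simp add: is_green_def)
  have "(\<Sum>v\<in>\<Lambda>. incidence tail tip f u * green adj \<Lambda> u v * incidence tail tip g v)
      = incidence tail tip f u * (\<Sum>v\<in>\<Lambda>. incidence tail tip g v * green adj \<Lambda> u v)" for u
    by (simp add: sum_distrib_left mult_ac)
  then have "(\<Sum>v\<in>\<Lambda>. incidence tail tip f u * green adj \<Lambda> u v * incidence tail tip g v)
      = incidence tail tip f u * (green adj \<Lambda> u (tip g) - green adj \<Lambda> u (tail g))" for u
    using *[of "green adj \<Lambda> u" g] zero by simp
  then show ?thesis
    using *[of "\<lambda>u. green adj \<Lambda> u (tip g) - green adj \<Lambda> u (tail g)" f] zero
    by (simp add: transfer_current_def)
qed

lemma set_det_perturbation:
  assumes "finite \<Lambda>" "distinct es" "set_det \<Lambda> (\<lambda>u v. - laplacian adj u v) \<noteq> 0"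
  shows "set_det \<Lambda> (\<lambda>u v. - laplacian adj u v + (\<Sum>e\<in>set es. x e * incidence tail tip e u * incidence tail tip e v))
      / set_det \<Lambda> (\<lambda>u v. - laplacian adj u v)
    = set_det (set es) (\<lambda>e f. (if e = f then 1 else 0) + x e * transfer_current adj \<Lambda> tail tip e f)"
proof -
  obtain us where us: "set us = \<Lambda>" "distinct us"
    using finite_distinct_list[OF assms(1)] by blast
  let ?n = "length us" and ?m = "length es" and ?b = "incidence tail tip"
  let ?g = "green adj \<Lambda>"
  have green: "is_green adj \<Lambda> ?g" by (rule is_green_green[OF assms(1,3)])
  define A where "A = Matrix.mat ?n ?n (\<lambda>(i, j). - laplacian adj (us ! i) (us ! j))"
  define G where "G = Matrix.mat ?n ?n (\<lambda>(i, j). ?g (us ! i) (us ! j))"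
  define B where "B = Matrix.mat ?n ?m (\<lambda>(i, j). ?b (es ! j) (us ! i))"
  \<comment> \<open>The weights sit in the left factor of \<open>X * (G * B)\<close>, so
    \<open>x\<close> scales rows; in the final matrix, too, the sign depends on the row.\<close>
  define X where "X = Matrix.mat ?m ?n (\<lambda>(i, j). x (es ! i) * ?b (es ! i) (us ! j))"
  have carrier [simp]: "A \<in> carrier_mat ?n ?n" "G \<in> carrier_mat ?n ?n" "B \<in> carrier_mat ?n ?m" "X \<in> carrier_mat ?m ?n"
    by (simp_all add: A_def G_def B_def X_def)
  note sum_us = sum_nth_eq_sum_set[OF us(2), unfolded us(1)]
  note sum_es = sum_nth_eq_sum_set[OF assms(2)]
  have AG: "A * G = 1\<^sub>m ?n"
  proof (rule eq_matI)
    fix i j assume "i < dim_row (1\<^sub>m ?n :: real mat)" "j < dim_col (1\<^sub>m ?n :: real mat)"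
    then have ij: "i < ?n" "j < ?n" by simp_all
    then have "us ! i \<in> \<Lambda>" "us ! j \<in> \<Lambda>" using us(1) by auto
    then have "(\<Sum>w\<in>\<Lambda>. - laplacian adj (us ! i) w * ?g w (us ! j)) = (if us ! i = us ! j then 1 else 0)"
      using green by (simp add: is_green_def)
    then show "(A * G) $$ (i, j) = 1\<^sub>m ?n $$ (i, j)"
      using ij us(2) sum_us[of "\<lambda>w. - laplacian adj (us ! i) w * ?g w (us ! j)"]
      by (simp add: A_def G_def scalar_prod_def nth_eq_iff_index_eq)
  qed (simp_all add: A_def G_def)
  have "Matrix.mat ?n ?n (\<lambda>(i, j). - laplacian adj (us ! i) (us ! j) + (\<Sum>e\<in>set es. x e * ?b e (us ! i) * ?b e (us ! j)))
      = A + B * X"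
    by (rule eq_matI) (auto simp: A_def B_def X_def scalar_prod_def mult_ac simp flip: sum_es)
  also have "\<dots> = A * (1\<^sub>m ?n + (G * B) * X)"
  proof -
    have "A * ((G * B) * X) = (A * G) * (B * X)"
      using carrier by (smt (verit) assoc_mult_mat mult_carrier_mat)
    also have "\<dots> = B * X" using AG by (simp add: left_mult_one_mat[of _ ?n ?n] mult_carrier_mat[of _ _ ?m])
    finally show ?thesis
      using mult_add_distrib_mat[OF carrier(1) one_carrier_mat mult_carrier_mat[OF mult_carrier_mat[OF carrier(2,3)] carrier(4)]]
      by (simp add: right_mult_one_mat[OF carrier(1)])
  qed
  finally have "set_det \<Lambda> (\<lambda>u v. - laplacian adj u v + (\<Sum>e\<in>set es. x e * ?b e u * ?b e v))
      = Determinant.det (A * (1\<^sub>m ?n + (G * B) * X))"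
    using set_det_eq_det[OF us(2)] us(1) by simp
  also have "\<dots> = Determinant.det A * Determinant.det (1\<^sub>m ?n + (G * B) * X)"
    by (rule det_mult[OF carrier(1) add_carrier_mat[OF mult_carrier_mat[OF mult_carrier_mat[OF carrier(2,3)] carrier(4)]]])
  also have "Determinant.det (1\<^sub>m ?n + (G * B) * X) = Determinant.det (1\<^sub>m ?m + X * (G * B))"
    by (rule det_one_plus_mult_commute[OF mult_carrier_mat[OF carrier(2,3)] carrier(4)])
  also have "1\<^sub>m ?m + X * (G * B) = Matrix.mat ?m ?m (\<lambda>(i, j). (if es ! i = es ! j then 1 else 0)
      + x (es ! i) * transfer_current adj \<Lambda> tail tip (es ! i) (es ! j))"
  proof (rule eq_matI)
    fix i j assume "i < dim_row (Matrix.mat ?m ?m (\<lambda>(i, j). (if es ! i = es ! j then 1 else 0)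
      + x (es ! i) * transfer_current adj \<Lambda> tail tip (es ! i) (es ! j)))"
      "j < dim_col (Matrix.mat ?m ?m (\<lambda>(i, j). (if es ! i = es ! j then 1 else 0)
      + x (es ! i) * transfer_current adj \<Lambda> tail tip (es ! i) (es ! j)))"
    then have ij: "i < ?m" "j < ?m" by simp_all
    have GB: "(G * B) $$ (k, j) = (\<Sum>v\<in>\<Lambda>. ?g (us ! k) v * ?b (es ! j) v)" if "k < ?n" for k
      using ij that by (simp add: G_def B_def scalar_prod_def flip: sum_us)
    have "(X * (G * B)) $$ (i, j) = (\<Sum>k = 0..<?n. X $$ (i, k) * (G * B) $$ (k, j))"
      using ij by (simp add: scalar_prod_def X_def G_def B_def)
    also have "\<dots> = (\<Sum>k = 0..<?n. x (es ! i) * ?b (es ! i) (us ! k) * (\<Sum>v\<in>\<Lambda>. ?g (us ! k) v * ?b (es ! j) v))"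
      using ij by (intro sum.cong) (auto simp: GB X_def)
    also have "\<dots> = (\<Sum>u\<in>\<Lambda>. x (es ! i) * ?b (es ! i) u * (\<Sum>v\<in>\<Lambda>. ?g u v * ?b (es ! j) v))"
      by (rule sum_us)
    also have "\<dots> = x (es ! i) * transfer_current adj \<Lambda> tail tip (es ! i) (es ! j)"
      by (simp add: transfer_current_eq_sum[OF assms(1) green] sum_distrib_left mult_ac)
    finally have "(X * (G * B)) $$ (i, j) = x (es ! i) * transfer_current adj \<Lambda> tail tip (es ! i) (es ! j)" .
    moreover have "(1\<^sub>m ?m + X * (G * B)) $$ (i, j) = 1\<^sub>m ?m $$ (i, j) + (X * (G * B)) $$ (i, j)"
      using ij by (intro index_add_mat(1)) (simp_all add: X_def B_def)
    ultimately show "(1\<^sub>m ?m + X * (G * B)) $$ (i, j) = Matrix.mat ?m ?m (\<lambda>(i, j). (if es ! i = es ! j then 1 else 0)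
      + x (es ! i) * transfer_current adj \<Lambda> tail tip (es ! i) (es ! j)) $$ (i, j)"
      using ij assms(2) by (simp add: nth_eq_iff_index_eq del: index_mult_mat)
  qed (simp_all add: X_def B_def)
  also have "Determinant.det \<dots> = set_det (set es) (\<lambda>e f. (if e = f then 1 else 0) + x e * transfer_current adj \<Lambda> tail tip e f)"
    using set_det_eq_det[OF assms(2)] by simp
  also have "Determinant.det A = set_det \<Lambda> (\<lambda>u v. - laplacian adj u v)"
    using set_det_eq_det[OF us(2)] us(1) by (simp add: A_def)
  finally show ?thesis using assms(3) by simp
qed

section \<open>Multi-affine functions\<close>

text \<open>
  Linearity in each pair \<open>(a e, x e)\<close>, in the form needed for an induction towards \<open>a = 1\<close>: the pair
  \<open>(a e, x e)\<close> is \<open>(1, x e) + (a e - 1) (1, 0)\<close>.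
\<close>

definition multi_affine :: "'e set \<Rightarrow> (('e \<Rightarrow> real) \<Rightarrow> ('e \<Rightarrow> real) \<Rightarrow> real) \<Rightarrow> bool" where
  "multi_affine S f \<longleftrightarrow> (\<forall>e\<in>S. \<forall>a x. f a x = f (a(e := 1)) x + (a e - 1) * f (a(e := 1)) (x(e := 0)))"

text \<open>Each use of the identity sets one coordinate of \<open>a\<close> to 1 but may also
  change \<open>x\<close>; hence the induction over the coordinates still free keeps both
  \<open>a\<close> and \<open>x\<close> arbitrary.\<close>

lemma multi_affine_eqI:
  assumes "finite S" "multi_affine S f" "multi_affine S g"
    and "\<And>a x. (\<And>e. e \<in> S \<Longrightarrow> a e = 1) \<Longrightarrow> f a x = g a x"
  shows "f a x = g a x"
proof -
  have "f a x = g a x" if "finite K" "K \<subseteq> S" "\<And>e. e \<in> S - K \<Longrightarrow> a e = 1" for K a x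
    using that
  proof (induction K arbitrary: a x)
    case empty
    then show ?case using assms(4) by simp
  next
    case (insert e K)
    have "f (a(e := 1)) y = g (a(e := 1)) y" for y
      using insert.prems by (intro insert.IH) auto
    moreover have "e \<in> S" using insert.prems by simp
    ultimately show ?case using assms(2,3) unfolding multi_affine_def by metis
  qed
  from this[OF assms(1) order.refl] show ?thesis by simp
qed

lemma multi_affine_prod:
  assumes "finite S"
  shows "multi_affine S (\<lambda>a x. \<Prod>e\<in>S. a e * d e + x e * m e)"
  unfolding multi_affine_def
proof (intro ballI allI)
  fix e and a x :: "'a \<Rightarrow> real" assume e: "e \<in> S"
  let ?R = "\<Prod>f\<in>S - {e}. a f * d f + x f * m f"
  have "(\<Prod>f\<in>S - {e}. (a(e := c)) f * d f + (x(e := c')) f * m f) = ?R" for c c'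
    by (intro prod.cong) auto
  from this[of 1 "x e"] this[of 1 0]
  show "(\<Prod>e\<in>S. a e * d e + x e * m e) = (\<Prod>f\<in>S. (a(e := 1)) f * d f + x f * m f)
      + (a e - 1) * (\<Prod>f\<in>S. (a(e := 1)) f * d f + (x(e := 0)) f * m f)"
    unfolding prod.remove[OF assms e] by (simp add: algebra_simps)
qed

text \<open>The coefficients \<open>c\<close> will be the signs of permutations and the
  probabilities of trees.\<close>

lemma multi_affine_sum:
  assumes "\<And>i. i \<in> I \<Longrightarrow> multi_affine S (f i)"
  shows "multi_affine S (\<lambda>a x. \<Sum>i\<in>I. c i * f i a x)"
  unfolding multi_affine_def
proof (intro ballI allI)
  fix e and a x :: "'b \<Rightarrow> real" assume "e \<in> S"
  then have eq: "f i a x = f i (a(e := 1)) x + (a e - 1) * f i (a(e := 1)) (x(e := 0))" if "i \<in> I" for i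
    using assms[OF that] unfolding multi_affine_def by blast
  have "(\<Sum>i\<in>I. c i * f i a x)
      = (\<Sum>i\<in>I. c i * f i (a(e := 1)) x + (a e - 1) * (c i * f i (a(e := 1)) (x(e := 0))))"
    by (intro sum.cong refl) (subst eq, simp_all add: algebra_simps)
  then show "(\<Sum>i\<in>I. c i * f i a x)
      = (\<Sum>i\<in>I. c i * f i (a(e := 1)) x) + (a e - 1) * (\<Sum>i\<in>I. c i * f i (a(e := 1)) (x(e := 0)))"
    by (simp add: sum.distrib sum_distrib_left)
qed

text \<open>Each Leibniz term takes one factor from row \<open>e\<close>, and \<open>a e\<close> and
  \<open>x e\<close> occur in that row alone.\<close>

lemma multi_affine_set_det:
  assumes "finite S"
  shows "multi_affine S (\<lambda>a x. set_det S (\<lambda>e f. a e * (if e = f then 1 else 0) + x e * m e f))"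
  unfolding set_det_def by (intro multi_affine_sum multi_affine_prod assms)

lemma linear_fermion_state:
  assumes "finite \<Lambda>"
  shows "linear (fermion_state adj \<Lambda>)"
  using linear_berezin[OF assms] unfolding fermion_state_def berezin_def[symmetric]
  by (intro linearI) (simp_all add: distrib_left linear_add linear_scale)

text \<open>Splitting the list at \<open>e\<close> preserves the order of the factors; distinctness
  confines \<open>a e\<close> and \<open>x e\<close> to a single factor.\<close>

lemma multi_affine_fermion_state:
  assumes "finite \<Lambda>" "distinct es"
  shows "multi_affine (set es) (\<lambda>a x. fermion_state adj \<Lambda> (\<Prod>e\<leftarrow>es. a e *\<^sub>R 1 + x e *\<^sub>R z e))"
  unfolding multi_affine_def
proof (intro ballI allI)
  fix e and a x :: "'b \<Rightarrow> real" assume "e \<in> set es"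
  then obtain ys zs where es: "es = ys @ e # zs" by (meson split_list)
  let ?p = "\<lambda>xs. \<Prod>e\<leftarrow>xs. a e *\<^sub>R 1 + x e *\<^sub>R z e"
  have p: "(\<Prod>f\<leftarrow>xs. (a(e := c)) f *\<^sub>R 1 + (x(e := c')) f *\<^sub>R z f) = ?p xs" if "e \<notin> set xs" for xs c c'
    using that by (intro arg_cong[where f = prod_list] map_cong) auto
  have "e \<notin> set ys" "e \<notin> set zs" using assms(2) es by auto
  note p = this[THEN p, of 1 "x e"] this[THEN p, of 1 0]
  have "?p es = (\<Prod>f\<leftarrow>es. (a(e := 1)) f *\<^sub>R 1 + x f *\<^sub>R z f)
      + (a e - 1) *\<^sub>R (\<Prod>f\<leftarrow>es. (a(e := 1)) f *\<^sub>R 1 + (x(e := 0)) f *\<^sub>R z f)"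
    using p by (simp add: es algebra_simps)
  then show "fermion_state adj \<Lambda> (?p es) = fermion_state adj \<Lambda> (\<Prod>f\<leftarrow>es. (a(e := 1)) f *\<^sub>R 1 + x f *\<^sub>R z f)
      + (a e - 1) * fermion_state adj \<Lambda> (\<Prod>f\<leftarrow>es. (a(e := 1)) f *\<^sub>R 1 + (x(e := 0)) f *\<^sub>R z f)"
    by (simp add: linear_add[OF linear_fermion_state[OF assms(1)]] linear_scale[OF linear_fermion_state[OF assms(1)]])
qed

section \<open>Spanning trees of the wired graph\<close>

lemma set_det_cong:
  "(\<And>u v. u \<in> I \<Longrightarrow> v \<in> I \<Longrightarrow> A u v = B u v) \<Longrightarrow> set_det I A = set_det I B"
  unfolding set_det_def by (intro sum.cong prod.cong arg_cong2[where f = "(*)"]) (auto simp: permutes_in_image)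

lemma wire_in: "wire \<Lambda> v \<in> insert None (Some ` \<Lambda>)"
  by (simp add: wire_def)

text \<open>A walk in the original graph from a vertex outside \<open>\<Lambda>\<close> projects to
  the wired graph; steps with both ends outside collapse to \<open>None\<close>.\<close>

lemma mg_connected_wired:
  assumes "simple_graph V adj" "connected_graph V adj" "\<Lambda> \<subset> V"
  shows "mg_connected (insert None (Some ` \<Lambda>)) (\<lambda>e. wire \<Lambda> ` e) (edges_touching adj \<Lambda>)"
proof -
  let ?R = "mg_reach (\<lambda>e. wire \<Lambda> ` e) (edges_touching adj \<Lambda>)"
  obtain r where r: "r \<in> V" "r \<notin> \<Lambda>" using assms(3) by blast
  have reach: "?R None (wire \<Lambda> x)" if "adj\<^sup>*\<^sup>* r x" for x
    using that
  proof (induction rule: rtranclp_induct)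
    case base
    then show ?case using r(2) by (simp add: wire_def)
  next
    case (step y z)
    show ?case
    proof (cases "y \<in> \<Lambda> \<or> z \<in> \<Lambda>")
      case True
      with step.hyps(2) have "{y, z} \<in> edges_touching adj \<Lambda>" by (auto simp: edges_touching_def)
      then have "?R (wire \<Lambda> y) (wire \<Lambda> z)" by (rule mg_reach_edge) simp
      with step.IH show ?thesis by (rule mg_reach_trans)
    next
      case False
      then show ?thesis by (simp add: wire_def)
    qed
  qed
  have "?R None (Some x)" if "x \<in> \<Lambda>" for x
  proof -
    have "adj\<^sup>*\<^sup>* r x" using that assms(2,3) r(1) unfolding connected_graph_def by blast
    from reach[OF this] that show ?thesis by (simp only: wire_def if_True)
  qed
  then show ?thesis
    by (subst mg_connected_iff_root[of None]) auto
qed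

section \<open>The identities for a fixed wired graph\<close>

locale wired_graph =
  fixes V \<Lambda> :: "'v set" and adj :: "'v \<Rightarrow> 'v \<Rightarrow> bool" and tail tip :: "'v set \<Rightarrow> 'v"
  assumes simple: "simple_graph V adj" and conn: "connected_graph V adj" and loc_fin: "locally_finite_graph V adj"
    and fin: "finite \<Lambda>" and subset: "\<Lambda> \<subset> V" and orient: "orientation (edges_touching adj \<Lambda>) tail tip"
begin

abbreviation "E \<equiv> edges_touching adj \<Lambda>"
abbreviation "b \<equiv> incidence tail tip"

lemma finite_E: "finite E"
  using edges_touching_finite[OF simple loc_fin fin] subset by blast

lemma wired_ends:
  "e \<in> E \<Longrightarrow> wire \<Lambda> ` e = {wire \<Lambda> (tail e), wire \<Lambda> (tip e)}"
  using orientation_adj(1)[OF simple orient, of e] by (metis image_empty image_insert)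

text \<open>Wiring merges only vertices outside \<open>\<Lambda>\<close>, whose coordinates the
  determinant does not read.\<close>

lemma incidence_wire: "u \<in> \<Lambda> \<Longrightarrow> incidence (\<lambda>e. wire \<Lambda> (tail e)) (\<lambda>e. wire \<Lambda> (tip e)) e (Some u) = b e u"
  by (auto simp: incidence_def wire_def)

lemma set_det_weighted_laplacian:
  "set_det \<Lambda> (\<lambda>u v. \<Sum>e\<in>E. w e * b e u * b e v) = (\<Sum>T\<in>wired_spanning_trees adj \<Lambda>. \<Prod>e\<in>T. w e)"
proof -
  have "set_det \<Lambda> (\<lambda>u v. \<Sum>e\<in>E. w e * b e u * b e v)
      = set_det \<Lambda> (\<lambda>u v. \<Sum>e\<in>E. w e * incidence (\<lambda>e. wire \<Lambda> (tail e)) (\<lambda>e. wire \<Lambda> (tip e)) e (Some u)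
          * incidence (\<lambda>e. wire \<Lambda> (tail e)) (\<lambda>e. wire \<Lambda> (tip e)) e (Some v))"
    by (intro set_det_cong) (simp add: incidence_wire)
  also have "\<dots> = (\<Sum>T\<in>wired_spanning_trees adj \<Lambda>. \<Prod>e\<in>T. w e)"
    unfolding wired_spanning_trees_def
    by (rule weighted_matrix_tree[OF fin finite_E wired_ends wire_in wire_in])
  finally show ?thesis .
qed

lemma wired_spanning_trees_subset: "T \<in> wired_spanning_trees adj \<Lambda> \<Longrightarrow> T \<subseteq> E"
  by (simp add: wired_spanning_trees_def spanning_tree_def)

lemma finite_wired_spanning_trees: "finite (wired_spanning_trees adj \<Lambda>)"
proof (rule finite_subset)
  show "wired_spanning_trees adj \<Lambda> \<subseteq> Pow E" using wired_spanning_trees_subset by blast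
qed (simp add: finite_E)

text \<open>Makes the uniform measure meaningful and the Laplacian invertible. A connected set with
  at most \<open>card \<Lambda>\<close> edges has exactly that many and so is a tree.\<close>

lemma wired_spanning_trees_nonempty: "wired_spanning_trees adj \<Lambda> \<noteq> {}"
proof -
  let ?W = "insert None (Some ` \<Lambda>)" and ?ends = "\<lambda>e. wire \<Lambda> ` e"
  obtain T where T: "T \<subseteq> E" "card T \<le> card (Some ` \<Lambda>)" "mg_connected ?W ?ends T"
  proof (rule mg_connected_small_subset[of "Some ` \<Lambda>" None ?ends E])
    show "mg_connected ?W ?ends E" by (rule mg_connected_wired[OF simple conn subset])
    show "wire \<Lambda> ` e \<subseteq> ?W" if "e \<in> E" for e by (rule image_subsetI) (rule wire_in)
  qed (use fin in auto)
  have "finite T" using T(1) finite_E by (rule finite_subset)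
  have "card T = card \<Lambda>"
    using T wired_ends
    by (intro set_det_connected(1)[OF fin \<open>finite T\<close>, of ?ends "\<lambda>e. wire \<Lambda> (tail e)" "\<lambda>e. wire \<Lambda> (tip e)"])
      (auto simp: card_image)
  with T have "spanning_tree ?W E ?ends T"
    using spanning_tree_iff[of \<Lambda> E ?ends "\<lambda>e. wire \<Lambda> (tail e)" "\<lambda>e. wire \<Lambda> (tip e)" T,
        OF fin finite_E wired_ends wire_in wire_in] by blast
  then show ?thesis by (auto simp: wired_spanning_trees_def)
qed

text \<open>Kirchhoff's count, from unit weights; so the state and the uniform measure are
  normalised by the same number.\<close>

lemma set_det_laplacian:
  "set_det \<Lambda> (\<lambda>u v. - laplacian adj u v) = card (wired_spanning_trees adj \<Lambda>)"
proof -
  have "set_det \<Lambda> (\<lambda>u v. - laplacian adj u v) = set_det \<Lambda> (\<lambda>u v. \<Sum>e\<in>E. 1 * b e u * b e v)"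
    using neg_laplacian_eq_sum_incidence[OF simple loc_fin fin _ orient] subset
    by (intro set_det_cong) auto
  then show ?thesis unfolding set_det_weighted_laplacian by simp
qed

lemma set_det_laplacian_nonzero: "set_det \<Lambda> (\<lambda>u v. - laplacian adj u v) \<noteq> 0"
  using finite_wired_spanning_trees wired_spanning_trees_nonempty by (simp add: set_det_laplacian)

lemma fermion_state_eq_trees:
  assumes "distinct es" "set es \<subseteq> E"
  shows "fermion_state adj \<Lambda> (\<Prod>e\<leftarrow>es. 1 + x e *\<^sub>R zeta \<Lambda> tail tip e)
    = (\<Sum>T\<in>wired_spanning_trees adj \<Lambda>. 1 / card (wired_spanning_trees adj \<Lambda>) *
        (\<Prod>e\<in>set es. 1 + x e * (if e \<in> T then 1 else 0)))"
proof -
  \<comment> \<open>Edges not listed in \<open>es\<close> keep weight 1, so the weight of a tree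
    involves only its edges in \<open>es\<close>.\<close>
  let ?w = "\<lambda>e. 1 + (if e \<in> set es then x e else 0)"
  have "set_det \<Lambda> (\<lambda>u v. - laplacian adj u v + (\<Sum>e\<in>set es. x e * b e u * b e v))
      = set_det \<Lambda> (\<lambda>u v. \<Sum>e\<in>E. ?w e * b e u * b e v)"
  proof (rule set_det_cong)
    fix u v assume "u \<in> \<Lambda>" "v \<in> \<Lambda>"
    then have "- laplacian adj u v = (\<Sum>e\<in>E. b e u * b e v)"
      using neg_laplacian_eq_sum_incidence[OF simple loc_fin fin _ orient] subset by auto
    moreover have "(\<Sum>e\<in>set es. x e * b e u * b e v) = (\<Sum>e\<in>E. (if e \<in> set es then x e else 0) * b e u * b e v)"
      using assms(2) finite_E by (intro sum.mono_neutral_cong_left) auto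
    ultimately show "- laplacian adj u v + (\<Sum>e\<in>set es. x e * b e u * b e v) = (\<Sum>e\<in>E. ?w e * b e u * b e v)"
      by (simp add: distrib_right sum.distrib)
  qed
  also have "\<dots> = (\<Sum>T\<in>wired_spanning_trees adj \<Lambda>. \<Prod>e\<in>T. ?w e)"
    by (rule set_det_weighted_laplacian)
  also have "\<dots> = (\<Sum>T\<in>wired_spanning_trees adj \<Lambda>. \<Prod>e\<in>set es. 1 + x e * (if e \<in> T then 1 else 0))"
  proof (intro sum.cong refl)
    fix T assume "T \<in> wired_spanning_trees adj \<Lambda>"
    then have "finite T" using wired_spanning_trees_subset finite_E finite_subset by blast
    then have "(\<Prod>e\<in>T. ?w e) = (\<Prod>e\<in>T \<inter> set es. 1 + x e)"
      by (intro prod.mono_neutral_cong_right) auto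
    also have "\<dots> = (\<Prod>e\<in>set es. 1 + x e * (if e \<in> T then 1 else 0))"
      by (intro prod.mono_neutral_cong_left) auto
    finally show "(\<Prod>e\<in>T. ?w e) = (\<Prod>e\<in>set es. 1 + x e * (if e \<in> T then 1 else 0))" .
  qed
  finally show ?thesis
    unfolding fermion_state_prod_list[OF fin assms(1)] set_det_laplacian
    by (simp add: sum_divide_distrib)
qed

lemma fermion_state_eq_det:
  assumes "distinct es"
  shows "fermion_state adj \<Lambda> (\<Prod>e\<leftarrow>es. 1 + x e *\<^sub>R zeta \<Lambda> tail tip e)
    = set_det (set es) (\<lambda>e f. (if e = f then 1 else 0) + x e * transfer_current adj \<Lambda> tail tip e f)"
  unfolding fermion_state_prod_list[OF fin assms]
  by (rule set_det_perturbation[OF fin assms set_det_laplacian_nonzero])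

text \<open>The factor \<open>a e * 1\<close> is left unsimplified to give the tree side the shape
  that \<open>multi_affine_prod\<close> requires.\<close>

lemma fermion_state_affine_eq_trees:
  assumes "distinct es" "set es \<subseteq> E"
  shows "fermion_state adj \<Lambda> (\<Prod>e\<leftarrow>es. a e *\<^sub>R 1 + x e *\<^sub>R zeta \<Lambda> tail tip e)
    = (\<Sum>T\<in>wired_spanning_trees adj \<Lambda>. 1 / card (wired_spanning_trees adj \<Lambda>) *
        (\<Prod>e\<in>set es. a e * 1 + x e * (if e \<in> T then 1 else 0)))"
proof (rule multi_affine_eqI[where S = "set es"
      and f = "\<lambda>a x. fermion_state adj \<Lambda> (\<Prod>e\<leftarrow>es. a e *\<^sub>R 1 + x e *\<^sub>R zeta \<Lambda> tail tip e)"
      and g = "\<lambda>a x. (\<Sum>T\<in>wired_spanning_trees adj \<Lambda>. 1 / card (wired_spanning_trees adj \<Lambda>) *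
        (\<Prod>e\<in>set es. a e * 1 + x e * (if e \<in> T then 1 else 0)))"])
  fix a x :: "'v set \<Rightarrow> real" assume a: "\<And>e. e \<in> set es \<Longrightarrow> a e = 1"
  have "(\<Prod>e\<leftarrow>es. a e *\<^sub>R 1 + x e *\<^sub>R zeta \<Lambda> tail tip e) = (\<Prod>e\<leftarrow>es. 1 + x e *\<^sub>R zeta \<Lambda> tail tip e)"
    by (intro arg_cong[where f = prod_list] map_cong) (simp_all add: a)
  then show "fermion_state adj \<Lambda> (\<Prod>e\<leftarrow>es. a e *\<^sub>R 1 + x e *\<^sub>R zeta \<Lambda> tail tip e)
    = (\<Sum>T\<in>wired_spanning_trees adj \<Lambda>. 1 / card (wired_spanning_trees adj \<Lambda>) *
        (\<Prod>e\<in>set es. a e * 1 + x e * (if e \<in> T then 1 else 0)))"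
    by (simp only: fermion_state_eq_trees[OF assms]) (simp add: a)
qed (intro finite_set multi_affine_fermion_state[OF fin assms(1)] multi_affine_sum multi_affine_prod)+

lemma fermion_state_affine_eq_det:
  assumes "distinct es"
  shows "fermion_state adj \<Lambda> (\<Prod>e\<leftarrow>es. a e *\<^sub>R 1 + x e *\<^sub>R zeta \<Lambda> tail tip e)
    = set_det (set es) (\<lambda>e f. a e * (if e = f then 1 else 0) + x e * transfer_current adj \<Lambda> tail tip e f)"
proof (rule multi_affine_eqI[where S = "set es"
      and f = "\<lambda>a x. fermion_state adj \<Lambda> (\<Prod>e\<leftarrow>es. a e *\<^sub>R 1 + x e *\<^sub>R zeta \<Lambda> tail tip e)"
      and g = "\<lambda>a x. set_det (set es) (\<lambda>e f. a e * (if e = f then 1 else 0) + x e * transfer_current adj \<Lambda> tail tip e f)"])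
  fix a x :: "'v set \<Rightarrow> real" assume a: "\<And>e. e \<in> set es \<Longrightarrow> a e = 1"
  have "(\<Prod>e\<leftarrow>es. a e *\<^sub>R 1 + x e *\<^sub>R zeta \<Lambda> tail tip e) = (\<Prod>e\<leftarrow>es. 1 + x e *\<^sub>R zeta \<Lambda> tail tip e)"
    by (intro arg_cong[where f = prod_list] map_cong) (simp_all add: a)
  then show "fermion_state adj \<Lambda> (\<Prod>e\<leftarrow>es. a e *\<^sub>R 1 + x e *\<^sub>R zeta \<Lambda> tail tip e)
    = set_det (set es) (\<lambda>e f. a e * (if e = f then 1 else 0) + x e * transfer_current adj \<Lambda> tail tip e f)"
    unfolding fermion_state_eq_det[OF assms] by (simp add: fermion_state_eq_det[OF assms] a cong: set_det_cong)
qed (intro finite_set multi_affine_fermion_state[OF fin assms] multi_affine_set_det)+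

end

text \<open>The lists \<open>fs\<close> and \<open>gs\<close> fix both the order of the products and
  the enumeration of the rows and columns.\<close>

theorem proposition3p6:
  fixes V \<Lambda> :: "'v set" and adj :: "'v \<Rightarrow> 'v \<Rightarrow> bool"
    and tail tip :: "'v set \<Rightarrow> 'v"
    and F G :: "'v set set" and fs gs :: "'v set list"
  assumes "simple_graph V adj" and "connected_graph V adj" and "locally_finite_graph V adj"
    and "finite \<Lambda>" and "\<Lambda> \<noteq> {}" and "\<Lambda> \<subset> V"
    and "orientation (edges_touching adj \<Lambda>) tail tip"
    and "F \<subseteq> edges_touching adj \<Lambda>" and "G \<subseteq> edges_touching adj \<Lambda>" and "F \<inter> G = {}"
    and "set fs = F" and "distinct fs" and "set gs = G" and "distinct gs"
  shows "measure_pmf.prob (UST adj \<Lambda>) {T. F \<subseteq> T \<and> G \<inter> T = {}}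
      = fermion_state adj \<Lambda>
          ((\<Prod>f\<leftarrow>fs. zeta \<Lambda> tail tip f) * (\<Prod>g\<leftarrow>gs. 1 - zeta \<Lambda> tail tip g))
    \<and> fermion_state adj \<Lambda>
          ((\<Prod>f\<leftarrow>fs. zeta \<Lambda> tail tip f) * (\<Prod>g\<leftarrow>gs. 1 - zeta \<Lambda> tail tip g))
      = (let M = (\<lambda>i j. transfer_current adj \<Lambda> tail tip ((fs @ gs) ! i) ((fs @ gs) ! j)) in
         Determinant.det (Matrix.mat (card F + card G) (card F + card G)
           (\<lambda>(i, j). if i < card F then M i j
                     else if i \<noteq> j then - M i j
                     else 1 - M i j)))"
proof -
  interpret wired_graph V \<Lambda> adj tail tip
    using assms by unfold_locales
  let ?es = "fs @ gs" and ?P = "(\<Prod>f\<leftarrow>fs. zeta \<Lambda> tail tip f) * (\<Prod>g\<leftarrow>gs. 1 - zeta \<Lambda> tail tip g)"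
  let ?Ts = "wired_spanning_trees adj \<Lambda>"
  \<comment> \<open>The pair \<open>(a, x) = (0, 1)\<close> turns a factor into
    \<open>zeta f\<close>, and \<open>(1, - 1)\<close> turns it into
    \<open>1 - zeta g\<close>.\<close>
  define a :: "'v set \<Rightarrow> real" where "a e = (if e \<in> F then 0 else 1)" for e
  define x :: "'v set \<Rightarrow> real" where "x e = (if e \<in> F then 1 else - 1)" for e
  have es: "distinct ?es" "set ?es = F \<union> G" "set ?es \<subseteq> E" using assms by auto
  have len: "length fs = card F" "length gs = card G" using assms distinct_card by metis+
  have fins: "finite F" "finite G" using assms(11,13) by auto
  have P: "?P = (\<Prod>e\<leftarrow>?es. a e *\<^sub>R 1 + x e *\<^sub>R zeta \<Lambda> tail tip e)"
    unfolding map_append prod_list.append using assms(10,11,13)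
    by (intro arg_cong2[where f = "(*)"] arg_cong[where f = prod_list] map_cong) (auto simp: a_def x_def)
  \<comment> \<open>With these values each factor on the tree side is the indicator of
    \<open>e \<in> T\<close> on \<open>F\<close> and of \<open>e \<notin> T\<close> on
    \<open>G\<close>.\<close>
  have ind: "(\<Prod>e\<in>set ?es. a e * 1 + x e * (if e \<in> T then 1 else 0)) = (if F \<subseteq> T \<and> G \<inter> T = {} then 1 else 0)" for T
  proof -
    have "(\<Prod>e\<in>set ?es. a e * 1 + x e * (if e \<in> T then 1 else 0))
        = (\<Prod>e\<in>F \<union> G. if e \<in> F \<and> e \<in> T \<or> e \<notin> F \<and> e \<notin> T then 1 else 0)"
      unfolding es(2) by (intro prod.cong) (auto simp: a_def x_def)
    also have "\<dots> = (if F \<subseteq> T \<and> G \<inter> T = {} then 1 else 0)"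
    proof (cases "F \<subseteq> T \<and> G \<inter> T = {}")
      case True
      then have "(\<Prod>e\<in>F \<union> G. if e \<in> F \<and> e \<in> T \<or> e \<notin> F \<and> e \<notin> T then 1 else 0 :: real) = (\<Prod>e\<in>F \<union> G. 1)"
        using assms(10) by (intro prod.cong) auto
      with True show ?thesis by simp
    next
      case False
      then obtain e where "e \<in> F \<union> G" "\<not> (e \<in> F \<and> e \<in> T \<or> e \<notin> F \<and> e \<notin> T)"
        using assms(10) by blast
      with False fins show ?thesis by (subst prod_zero) auto
    qed
    finally show ?thesis .
  qed
  have "measure_pmf.prob (UST adj \<Lambda>) {T. F \<subseteq> T \<and> G \<inter> T = {}}
      = card (?Ts \<inter> {T. F \<subseteq> T \<and> G \<inter> T = {}}) / card ?Ts"
    unfolding UST_def using wired_spanning_trees_nonempty finite_wired_spanning_trees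
    by (rule measure_pmf_of_set)
  also have "\<dots> = (\<Sum>T\<in>?Ts. 1 / card ?Ts * (if F \<subseteq> T \<and> G \<inter> T = {} then 1 else 0))"
    using finite_wired_spanning_trees by (simp add: sum.If_cases flip: sum_distrib_left sum_divide_distrib)
  also have "\<dots> = fermion_state adj \<Lambda> ?P"
    unfolding P fermion_state_affine_eq_trees[OF es(1,3)] ind ..
  finally have prob: "measure_pmf.prob (UST adj \<Lambda>) {T. F \<subseteq> T \<and> G \<inter> T = {}} = fermion_state adj \<Lambda> ?P" .
  have "fermion_state adj \<Lambda> ?P = Determinant.det (Matrix.mat (length ?es) (length ?es)
      (\<lambda>(i, j). a (?es ! i) * (if ?es ! i = ?es ! j then 1 else 0)
        + x (?es ! i) * transfer_current adj \<Lambda> tail tip (?es ! i) (?es ! j)))"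
    unfolding P fermion_state_affine_eq_det[OF es(1)] by (rule set_det_eq_det[OF es(1)])
  also have "Matrix.mat (length ?es) (length ?es)
      (\<lambda>(i, j). a (?es ! i) * (if ?es ! i = ?es ! j then 1 else 0)
        + x (?es ! i) * transfer_current adj \<Lambda> tail tip (?es ! i) (?es ! j))
    = Matrix.mat (card F + card G) (card F + card G)
      (\<lambda>(i, j). let M = (\<lambda>i j. transfer_current adj \<Lambda> tail tip (?es ! i) (?es ! j)) in
        if i < card F then M i j else if i \<noteq> j then - M i j else 1 - M i j)"
  proof -
    \<comment> \<open>Positions start at 0, so \<open>i < card F\<close> is the condition
      \<open>i \<le> |F|\<close> of the English statement; at later positions disjointness excludes
      \<open>F\<close>.\<close>
    have "?es ! i \<in> F \<longleftrightarrow> i < card F" if "i < card F + card G" for i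
    proof (cases "i < card F")
      case True
      then show ?thesis using assms(11) len by (auto simp: nth_append)
    next
      case False
      then have "?es ! i \<in> G" using that assms(13) len by (auto simp: nth_append)
      with False assms(10) show ?thesis by auto
    qed
    moreover have "?es ! i = ?es ! j \<longleftrightarrow> i = j" if "i < card F + card G" "j < card F + card G" for i j
      using that es(1) len by (intro nth_eq_iff_index_eq) auto
    ultimately show ?thesis by (intro cong_mat) (auto simp: a_def x_def len)
  qed
  finally show ?thesis using prob by (simp add: Let_def)
qed

end
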